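(* Let $X$ be the generator of a projectively Anosov flow on $M$ and let $\Omega$ be a volume form on $M$ which is $X$-differentiable. Then there exists a metric on $M$ such that $div_X\Omega=r_s+r_u$, where $r_s$ and $r_u$ are the expansion rates of the stable and unstable directions, respectively, measured by this metric.
   Context: Standing assumptions: $M$ is a closed connected oriented 3-manifold; $X$ is a non-vanishing $C^{1+}$ vector field on $M$ ($C^1$ with Hölder continuous derivatives) with flow $\phi^t$; the invariant bundles of the flow are transversely orientable. The flow induces a flow $\tilde\phi^t_*$ on $TM/\langle X\rangle$ via $\pi:TM\to TM/\langle X\rangle$. The flow is projectively Anosov if there is a continuous splitting into line bundles $TM/\langle X\rangle\simeq E^s\oplus E^u$, invariant under $\tilde\phi^t_*$, such that for some constant $C>0$ and some norm $\|\cdot\|$, $\|\tilde\phi^t_*(v)\|/\|\tilde\phi^t_*(u)\|\ge e^{Ct}\|v\|/\|u\|$ for all $t\ge 0$ and all nonzero $u\in E^s$, $v\in E^u$ over the same point. $E^s,E^u$ are the stable and unstable directions. A geometric quantity (function, form, norm, ...) is $X$-differentiable if it is differentiable in the direction of the flow of $X$. Volume forms are a priori only $C^0$. For an $X$-differentiable volume form $\Omega$, $div_X\Omega$ is the function with $\mathcal L_X\Omega=(div_X\Omega)\,\Omega$. Expansion rates: given an $X$-differentiable norm on $TM/\langle X\rangle$ induced by a metric, let $\tilde e_s\in E^s$, $\tilde e_u\in E^u$ be unit vectors and set $r_s=\frac{\partial}{\partial t}\ln\|\tilde\phi^t_*(\tilde e_s)\|\big|_{t=0}$, $r_u=\frac{\partial}{\partial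 t}\ln\|\tilde\phi^t_*(\tilde e_u)\|\big|_{t=0}$. A Riemannian metric on $M$ (a priori only continuous, with $X$-differentiable norm) measures expansion rates through the metric it induces on $TM/\langle X\rangle$ by identifying $TM/\langle X\rangle$ with the orthogonal complement of $X$. *)

theory Defs
  imports "HOL-Analysis.Analysis"
begin

section \<open>Smooth 3-manifolds\<close>

text \<open>
  The manifold is a Hausdorff type \<open>'a\<close> together with a smooth atlas of charts into
  \<open>real ^ 3\<close>. A chart is a pair of its domain and its coordinate map; the map is
  only relevant on the domain.
\<close>

type_synonym vec3 = "real ^ 3"
type_synonym 'a chart = "'a set \<times> ('a \<Rightarrow> vec3)"

text \<open>\<open>C_k_on k f S\<close> is meant for open \<open>S\<close>.\<close>

fun C_k_on :: "nat \<Rightarrow> ('b::real_normed_vector \<Rightarrow> 'c::real_normed_vector) \<Rightarrow> 'b set \<Rightarrow> bool" where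
  "C_k_on 0 f S \<longleftrightarrow> continuous_on S f"
| "C_k_on (Suc k) f S \<longleftrightarrow>
     f differentiable_on S \<and> (\<forall>v. C_k_on k (\<lambda>x. frechet_derivative f (at x) v) S)"

definition is_chart :: "'a::t2_space chart \<Rightarrow> bool" where
  "is_chart c \<longleftrightarrow> open (fst c) \<and> open (snd c ` fst c) \<and>
     (\<exists>g. homeomorphism (fst c) (snd c ` fst c) (snd c) g)"

definition chart_inv :: "'a chart \<Rightarrow> vec3 \<Rightarrow> 'a" where
  "chart_inv c = inv_into (fst c) (snd c)"

definition transition :: "'a chart \<Rightarrow> 'a chart \<Rightarrow> vec3 \<Rightarrow> vec3" where
  "transition c d = snd d \<circ> chart_inv c"

text \<open>
  The derivative of the change of coordinates from \<open>c\<close> to \<open>d\<close> at the point \<open>p\<close>.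
\<close>

definition coord_change :: "'a chart \<Rightarrow> 'a chart \<Rightarrow> 'a \<Rightarrow> vec3 \<Rightarrow> vec3" where
  "coord_change c d p = frechet_derivative (transition c d) (at (snd c p))"

definition smooth_atlas :: "'a::t2_space chart set \<Rightarrow> bool" where
  "smooth_atlas A \<longleftrightarrow>
     (\<forall>c\<in>A. is_chart c) \<and> (\<Union>c\<in>A. fst c) = UNIV \<and>
     (\<forall>c\<in>A. \<forall>d\<in>A. \<forall>k. C_k_on k (transition c d) (snd c ` (fst c \<inter> fst d)))"

definition oriented_atlas :: "'a::t2_space chart set \<Rightarrow> bool" where
  "oriented_atlas A \<longleftrightarrow> smooth_atlas A \<and>
     (\<forall>c\<in>A. \<forall>d\<in>A. \<forall>p \<in> fst c \<inter> fst d. det (matrix (coord_change c d p)) > 0)"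

definition closed_connected_oriented_3manifold :: "'a::t2_space chart set \<Rightarrow> bool" where
  "closed_connected_oriented_3manifold A \<longleftrightarrow>
     oriented_atlas A \<and> compact (UNIV :: 'a set) \<and> connected (UNIV :: 'a set)"


section \<open>Tangent vectors\<close>

text \<open>
  At every point one chart of the atlas is singled out, and a tangent vector at \<open>p\<close> is
  given by its coordinates in \<open>chart_at A p\<close>, so that every \<open>T\<^sub>pM\<close> is a copy of
  \<open>real ^ 3\<close>. The choice of \<open>chart_at\<close> need not depend continuously on \<open>p\<close>; hence
  regularity of fields is always expressed through the coordinates \<open>coord A c p v\<close> of
  \<open>v\<close> in a fixed chart \<open>c\<close>, and \<open>uncoord A c p\<close> is the inverse of \<open>coord A c p\<close>.
\<close>

definition chart_at :: "'a chart set \<Rightarrow> 'a \<Rightarrow> 'a chart" where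
  "chart_at A p = (SOME c. c \<in> A \<and> p \<in> fst c)"

definition coord :: "'a chart set \<Rightarrow> 'a chart \<Rightarrow> 'a \<Rightarrow> vec3 \<Rightarrow> vec3" where
  "coord A c p = coord_change (chart_at A p) c p"

definition uncoord :: "'a chart set \<Rightarrow> 'a chart \<Rightarrow> 'a \<Rightarrow> vec3 \<Rightarrow> vec3" where
  "uncoord A c p = coord_change c (chart_at A p) p"

definition tangent_map :: "'a chart set \<Rightarrow> ('a \<Rightarrow> 'a) \<Rightarrow> 'a \<Rightarrow> vec3 \<Rightarrow> vec3" where
  "tangent_map A h p =
     frechet_derivative (snd (chart_at A (h p)) \<circ> h \<circ> chart_inv (chart_at A p))
       (at (snd (chart_at A p) p))"

definition continuous_field_on :: "'a::t2_space chart set \<Rightarrow> 'a set \<Rightarrow> ('a \<Rightarrow> vec3) \<Rightarrow> bool" where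
  "continuous_field_on A V Y \<longleftrightarrow> (\<forall>c\<in>A. continuous_on (V \<inter> fst c) (\<lambda>p. coord A c p (Y p)))"

definition local_field :: "'a chart set \<Rightarrow> ('a \<Rightarrow> vec3) \<Rightarrow> 'a chart \<Rightarrow> vec3 \<Rightarrow> vec3" where
  "local_field A Y c y = coord A c (chart_inv c y) (Y (chart_inv c y))"

definition C1_Holder_field :: "'a::t2_space chart set \<Rightarrow> ('a \<Rightarrow> vec3) \<Rightarrow> bool" where
  "C1_Holder_field A Y \<longleftrightarrow>
     (\<forall>c\<in>A. C_k_on 1 (local_field A Y c) (snd c ` fst c)) \<and>
     (\<exists>\<alpha>. 0 < \<alpha> \<and> \<alpha> \<le> 1 \<and>
        (\<forall>c\<in>A. \<forall>y \<in> snd c ` fst c. \<exists>V K. open V \<and> y \<in> V \<and> V \<subseteq> snd c ` fst c \<and>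
           (\<forall>x\<in>V. \<forall>x'\<in>V. \<forall>v.
              norm (frechet_derivative (local_field A Y c) (at x) v
                    - frechet_derivative (local_field A Y c) (at x') v)
              \<le> K * dist x x' powr \<alpha> * norm v)))"


section \<open>Flows\<close>

definition C1_flow :: "'a::t2_space chart set \<Rightarrow> (real \<Rightarrow> 'a \<Rightarrow> 'a) \<Rightarrow> bool" where
  "C1_flow A \<phi> \<longleftrightarrow>
     (\<forall>p. \<phi> 0 p = p) \<and> (\<forall>s t p. \<phi> (s + t) p = \<phi> s (\<phi> t p)) \<and>
     continuous_on UNIV (\<lambda>(t, p). \<phi> t p) \<and>
     (\<forall>c\<in>A. \<forall>d\<in>A. C_k_on 1 (\<lambda>(t, y). snd d (\<phi> t (chart_inv c y)))
        {(t, y). y \<in> snd c ` fst c \<and> \<phi> t (chart_inv c y) \<in> fst d})"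

definition generates :: "'a::t2_space chart set \<Rightarrow> ('a \<Rightarrow> vec3) \<Rightarrow> (real \<Rightarrow> 'a \<Rightarrow> 'a) \<Rightarrow> bool" where
  "generates A X \<phi> \<longleftrightarrow>
     (\<forall>t p. \<forall>c\<in>A. \<phi> t p \<in> fst c \<longrightarrow>
        ((\<lambda>\<tau>. snd c (\<phi> \<tau> p)) has_vector_derivative coord A c (\<phi> t p) (X (\<phi> t p))) (at t))"


section \<open>The quotient bundle \<open>TM / \<langle>X\<rangle>\<close> and projectively Anosov flows\<close>

text \<open>
  The fibre of \<open>TM / \<langle>X\<rangle>\<close> at \<open>p\<close> consists of the cosets \<open>qproj X p v = v + \<langle>X p\<rangle>\<close>.
  Since a flow preserves its generator, its tangent map sends cosets onto cosets, and the
  induced flow is given by images of cosets.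
\<close>

definition qproj :: "('a \<Rightarrow> vec3) \<Rightarrow> 'a \<Rightarrow> vec3 \<Rightarrow> vec3 set" where
  "qproj X p v = {v + a *\<^sub>R X p | a. True}"

definition qflow :: "'a chart set \<Rightarrow> (real \<Rightarrow> 'a \<Rightarrow> 'a) \<Rightarrow> real \<Rightarrow> 'a \<Rightarrow> vec3 set \<Rightarrow> vec3 set" where
  "qflow A \<phi> t p q = tangent_map A (\<phi> t) p ` q"

definition qline :: "('a \<Rightarrow> vec3) \<Rightarrow> 'a \<Rightarrow> vec3 \<Rightarrow> vec3 set set" where
  "qline X p v = range (\<lambda>a. qproj X p (a *\<^sub>R v))"

definition continuous_line_subbundle ::
    "'a::t2_space chart set \<Rightarrow> ('a \<Rightarrow> vec3) \<Rightarrow> ('a \<Rightarrow> vec3 set set) \<Rightarrow> bool" where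
  "continuous_line_subbundle A X E \<longleftrightarrow>
     (\<forall>p. \<exists>V e. open V \<and> p \<in> V \<and> continuous_field_on A V e \<and>
        (\<forall>q\<in>V. qproj X q (e q) \<noteq> qproj X q 0 \<and> E q = qline X q (e q)))"

definition continuous_quotient_norm ::
    "'a::t2_space chart set \<Rightarrow> ('a \<Rightarrow> vec3) \<Rightarrow> ('a \<Rightarrow> vec3 set \<Rightarrow> real) \<Rightarrow> bool" where
  "continuous_quotient_norm A X N \<longleftrightarrow>
     (\<forall>p v. N p (qproj X p v) \<ge> 0 \<and> (N p (qproj X p v) = 0 \<longleftrightarrow> qproj X p v = qproj X p 0)) \<and>
     (\<forall>p a v. N p (qproj X p (a *\<^sub>R v)) = \<bar>a\<bar> * N p (qproj X p v)) \<and>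
     (\<forall>p v w. N p (qproj X p (v + w)) \<le> N p (qproj X p v) + N p (qproj X p w)) \<and>
     (\<forall>c\<in>A. continuous_on (fst c \<times> UNIV) (\<lambda>(p, v). N p (qproj X p (uncoord A c p v))))"

definition projectively_Anosov_splitting ::
    "'a::t2_space chart set \<Rightarrow> ('a \<Rightarrow> vec3) \<Rightarrow> (real \<Rightarrow> 'a \<Rightarrow> 'a) \<Rightarrow>
      ('a \<Rightarrow> vec3 set set) \<Rightarrow> ('a \<Rightarrow> vec3 set set) \<Rightarrow> bool" where
  "projectively_Anosov_splitting A X \<phi> Es Eu \<longleftrightarrow>
     continuous_line_subbundle A X Es \<and> continuous_line_subbundle A X Eu \<and>
     (\<forall>p. Es p \<inter> Eu p = {qproj X p 0}) \<and>
     (\<forall>p v. \<exists>u w. qproj X p u \<in> Es p \<and> qproj X p w \<in> Eu p \<and> v = u + w) \<and>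
     (\<forall>t p. qflow A \<phi> t p ` Es p = Es (\<phi> t p) \<and> qflow A \<phi> t p ` Eu p = Eu (\<phi> t p)) \<and>
     (\<exists>C>0. \<exists>N. continuous_quotient_norm A X N \<and>
        (\<forall>t\<ge>0. \<forall>p. \<forall>u\<in>Es p. \<forall>v\<in>Eu p. u \<noteq> qproj X p 0 \<longrightarrow> v \<noteq> qproj X p 0 \<longrightarrow>
           N (\<phi> t p) (qflow A \<phi> t p v) / N (\<phi> t p) (qflow A \<phi> t p u)
             \<ge> exp (C * t) * (N p v / N p u)))"

text \<open>
  The plane field \<open>\<pi>\<^sup>-\<^sup>1(E) \<subseteq> TM\<close> of a line subbundle \<open>E\<close> of \<open>TM / \<langle>X\<rangle>\<close> is the union
  of its cosets. A plane field is transversely orientable iff some global vector field is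
  transverse to it.
\<close>

definition transversely_orientable ::
    "'a::t2_space chart set \<Rightarrow> ('a \<Rightarrow> vec3 set set) \<Rightarrow> bool" where
  "transversely_orientable A E \<longleftrightarrow> (\<exists>n. continuous_field_on A UNIV n \<and> (\<forall>p. n p \<notin> \<Union>(E p)))"


section \<open>Volume forms and divergence\<close>

text \<open>Continuous and nowhere vanishing 3-forms.\<close>

definition volume_form ::
    "'a::t2_space chart set \<Rightarrow> ('a \<Rightarrow> vec3 \<Rightarrow> vec3 \<Rightarrow> vec3 \<Rightarrow> real) \<Rightarrow> bool" where
  "volume_form A \<Omega> \<longleftrightarrow>
     (\<forall>p u v. linear (\<lambda>w. \<Omega> p w u v) \<and> linear (\<lambda>w. \<Omega> p u w v) \<and> linear (\<lambda>w. \<Omega> p u v w)) \<and>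
     (\<forall>p u v. \<Omega> p u u v = 0 \<and> \<Omega> p u v u = 0 \<and> \<Omega> p v u u = 0) \<and>
     (\<forall>p. \<exists>u v w. \<Omega> p u v w \<noteq> 0) \<and>
     (\<forall>c\<in>A. \<forall>u v w. continuous_on (fst c)
        (\<lambda>p. \<Omega> p (uncoord A c p u) (uncoord A c p v) (uncoord A c p w)))"

definition pullback_form :: "'a chart set \<Rightarrow> ('a \<Rightarrow> 'a) \<Rightarrow> ('a \<Rightarrow> vec3 \<Rightarrow> vec3 \<Rightarrow> vec3 \<Rightarrow> real)
      \<Rightarrow> 'a \<Rightarrow> vec3 \<Rightarrow> vec3 \<Rightarrow> vec3 \<Rightarrow> real" where
  "pullback_form A h \<Omega> p u v w =
     \<Omega> (h p) (tangent_map A h p u) (tangent_map A h p v) (tangent_map A h p w)"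

definition X_differentiable_form :: "'a chart set \<Rightarrow> (real \<Rightarrow> 'a \<Rightarrow> 'a)
      \<Rightarrow> ('a \<Rightarrow> vec3 \<Rightarrow> vec3 \<Rightarrow> vec3 \<Rightarrow> real) \<Rightarrow> bool" where
  "X_differentiable_form A \<phi> \<Omega> \<longleftrightarrow>
     (\<forall>p u v w. (\<lambda>t. pullback_form A (\<phi> t) \<Omega> p u v w) differentiable (at 0))"

definition Lie_derivative_form :: "'a chart set \<Rightarrow> (real \<Rightarrow> 'a \<Rightarrow> 'a)
      \<Rightarrow> ('a \<Rightarrow> vec3 \<Rightarrow> vec3 \<Rightarrow> vec3 \<Rightarrow> real) \<Rightarrow> 'a \<Rightarrow> vec3 \<Rightarrow> vec3 \<Rightarrow> vec3 \<Rightarrow> real" where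
  "Lie_derivative_form A \<phi> \<Omega> p u v w = deriv (\<lambda>t. pullback_form A (\<phi> t) \<Omega> p u v w) 0"

definition divergence :: "'a chart set \<Rightarrow> (real \<Rightarrow> 'a \<Rightarrow> 'a)
      \<Rightarrow> ('a \<Rightarrow> vec3 \<Rightarrow> vec3 \<Rightarrow> vec3 \<Rightarrow> real) \<Rightarrow> 'a \<Rightarrow> real" where
  "divergence A \<phi> \<Omega> p =
     (THE d. \<forall>u v w. Lie_derivative_form A \<phi> \<Omega> p u v w = d * \<Omega> p u v w)"


section \<open>Riemannian metrics and expansion rates\<close>

definition continuous_metric ::
    "'a::t2_space chart set \<Rightarrow> ('a \<Rightarrow> vec3 \<Rightarrow> vec3 \<Rightarrow> real) \<Rightarrow> bool" where
  "continuous_metric A g \<longleftrightarrow>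
     (\<forall>p v. linear (g p v)) \<and> (\<forall>p v w. g p v w = g p w v) \<and> (\<forall>p v. v \<noteq> 0 \<longrightarrow> g p v v > 0) \<and>
     (\<forall>c\<in>A. \<forall>v w. continuous_on (fst c) (\<lambda>p. g p (uncoord A c p v) (uncoord A c p w)))"

definition X_differentiable_metric ::
    "'a chart set \<Rightarrow> (real \<Rightarrow> 'a \<Rightarrow> 'a) \<Rightarrow> ('a \<Rightarrow> vec3 \<Rightarrow> vec3 \<Rightarrow> real) \<Rightarrow> bool" where
  "X_differentiable_metric A \<phi> g \<longleftrightarrow>
     (\<forall>p v. v \<noteq> 0 \<longrightarrow>
        (\<lambda>t. sqrt (g (\<phi> t p) (tangent_map A (\<phi> t) p v) (tangent_map A (\<phi> t) p v)))
          differentiable (at 0))"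

text \<open>
  The norm on \<open>TM / \<langle>X\<rangle>\<close> induced by a metric: a coset has the length of its unique
  representative orthogonal to \<open>X\<close>.
\<close>

definition orth_rep ::
    "('a \<Rightarrow> vec3) \<Rightarrow> ('a \<Rightarrow> vec3 \<Rightarrow> vec3 \<Rightarrow> real) \<Rightarrow> 'a \<Rightarrow> vec3 set \<Rightarrow> vec3" where
  "orth_rep X g p q = (THE w. w \<in> q \<and> g p w (X p) = 0)"

definition induced_norm ::
    "('a \<Rightarrow> vec3) \<Rightarrow> ('a \<Rightarrow> vec3 \<Rightarrow> vec3 \<Rightarrow> real) \<Rightarrow> 'a \<Rightarrow> vec3 set \<Rightarrow> real" where
  "induced_norm X g p q = sqrt (g p (orth_rep X g p q) (orth_rep X g p q))"

text \<open>The two unit vectors of the line \<open>E p\<close> have the same rate.\<close>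

definition expansion_rate :: "'a chart set \<Rightarrow> ('a \<Rightarrow> vec3) \<Rightarrow> (real \<Rightarrow> 'a \<Rightarrow> 'a)
      \<Rightarrow> ('a \<Rightarrow> vec3 \<Rightarrow> vec3 \<Rightarrow> real) \<Rightarrow> ('a \<Rightarrow> vec3 set set) \<Rightarrow> 'a \<Rightarrow> real" where
  "expansion_rate A X \<phi> g E p =
     (THE r. \<forall>e\<in>E p. induced_norm X g p e = 1 \<longrightarrow>
        ((\<lambda>t. ln (induced_norm X g (\<phi> t p) (qflow A \<phi> t p e))) has_real_derivative r) (at 0))"

end

theory Submission
  imports Defs
begin

text \<open>
  Suppose that \<open>e\<close> is a stable and \<open>f\<close> an unstable vector, and that a metric induces norms on the
  two lines with \<open>\<parallel>e\<parallel> \<parallel>f\<parallel> = \<bar>\<Omega>(X, e, f)\<bar>\<close>. The flow preserves \<open>X\<close> and both lines, so this identity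
  persists when \<open>e\<close> and \<open>f\<close> are carried along. The logarithmic derivative of the right-hand side is
  the divergence and that of the left-hand side is \<open>r\<^sub>s + r\<^sub>u\<close>. What has to be done is to choose such
  a metric that is continuous and differentiable along the flow.

  The metric is \<open>\<alpha>\<^sup>2 + \<sigma>\<^sup>2 + \<tau>\<^sup>2\<close> for three continuous 1-forms with \<open>\<alpha>(X) = 1\<close>, with \<open>\<sigma>\<close> vanishing
  on the plane of \<open>X\<close> and the unstable line, and \<open>\<tau>\<close> vanishing on the plane of \<open>X\<close> and the stable line.
  Working with 1-forms on the manifold in place of norms on lines avoids the choice of sections
  of the bundles, and everything but the form \<open>\<tau>\<close> is made differentiable along the flow by one and
  the same device: the average \<open>\<integral>\<^sub>0\<^sup>1 (\<phi>\<^sup>t)\<^sup>* \<alpha> dt\<close> is continuous when \<open>\<alpha>\<close> is, differentiable along the flow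
  (\<open>flow_average_differentiable\<close>), and has the same kernel when that kernel is invariant
  (\<open>flow_average_eq_value_on_orbit\<close>). The volume form enters twice. Transversality to the unstable
  plane provides, by contraction of \<open>\<Omega>\<close>, the form from which \<open>\<sigma>\<close> arises; then \<open>\<tau>\<close> is the contraction
  \<open>\<Omega>(X, e, \<cdot>) / \<sigma>(e)\<close>, which is exactly the normalisation needed above. Both are instances of
  \<open>exists_continuous_contraction\<close>, and \<open>exists_adapted_coframe\<close> collects the result.

  The remaining lemmas justify the calculus: the derivative of the flow is a cocycle that
  fixes \<open>X\<close> (\<open>dflow_add\<close>, \<open>dflow_generator\<close>), and divergence and rates may be read off from any frame
  of nonzero vectors (\<open>divergence_eq\<close>, \<open>expansion_rate_eq\<close>).
\<close>

section \<open>Charts\<close>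

locale smooth_manifold =
  fixes A :: "'a::t2_space chart set"
  assumes atlas: "smooth_atlas A"
begin

lemma chart_homeomorphism:
  assumes "c \<in> A"
  shows "homeomorphism (fst c) (snd c ` fst c) (snd c) (chart_inv c)"
proof -
  obtain g where g: "homeomorphism (fst c) (snd c ` fst c) (snd c) g"
    using assms atlas by (auto simp: smooth_atlas_def is_chart_def)
  have inj: "inj_on (snd c) (fst c)"
    using g by (intro inj_on_inverseI[of _ g]) (simp add: homeomorphism_def)
  have "chart_inv c y = g y" if "y \<in> snd c ` fst c" for y
    unfolding chart_inv_def using g inj that
    by (intro inv_into_f_eq) (auto simp: homeomorphism_def)
  then show ?thesis
    by (intro homeomorphism_cong[OF g]) simp_all
qed

lemma open_chart_domain: "c \<in> A \<Longrightarrow> open (fst c)"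
  and open_chart_image: "c \<in> A \<Longrightarrow> open (snd c ` fst c)"
  using atlas by (auto simp: smooth_atlas_def is_chart_def)

lemma continuous_on_chart: "c \<in> A \<Longrightarrow> continuous_on (fst c) (snd c)"
  and continuous_on_chart_inv: "c \<in> A \<Longrightarrow> continuous_on (snd c ` fst c) (chart_inv c)"
  and chart_inv_chart: "c \<in> A \<Longrightarrow> p \<in> fst c \<Longrightarrow> chart_inv c (snd c p) = p"
  using chart_homeomorphism[of c] by (auto simp: homeomorphism_def)

lemma chart_inv_in_domain: "c \<in> A \<Longrightarrow> y \<in> snd c ` fst c \<Longrightarrow> chart_inv c y \<in> fst c"
  and chart_chart_inv: "c \<in> A \<Longrightarrow> y \<in> snd c ` fst c \<Longrightarrow> snd c (chart_inv c y) = y"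
  using chart_inv_chart[of c] by auto

lemma open_chart_image_subset:
  assumes "c \<in> A" "open U" "U \<subseteq> fst c"
  shows "open (snd c ` U)"
proof -
  have "snd c ` U = (snd c ` fst c) \<inter> chart_inv c -` U"
    using assms chart_inv_chart[OF assms(1)] by force
  moreover have "open \<dots>"
    using continuous_open_preimage[OF continuous_on_chart_inv open_chart_image] assms by simp
  ultimately show ?thesis by simp
qed

lemma open_overlap_image: "c \<in> A \<Longrightarrow> d \<in> A \<Longrightarrow> open (snd c ` (fst c \<inter> fst d))"
  by (intro open_chart_image_subset open_Int open_chart_domain) simp_all

lemma chart_at_in_atlas: "chart_at A p \<in> A"
  and point_in_chart_at: "p \<in> fst (chart_at A p)"
proof -
  have "\<exists>c. c \<in> A \<and> p \<in> fst c"
    using atlas unfolding smooth_atlas_def by blast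
  from someI_ex[OF this] show "chart_at A p \<in> A" "p \<in> fst (chart_at A p)"
    by (auto simp: chart_at_def)
qed

lemmas chart_at_simps [simp] = chart_at_in_atlas point_in_chart_at

section \<open>Changes of coordinates\<close>

lemma transition_has_derivative:
  assumes "c \<in> A" "d \<in> A" "p \<in> fst c" "p \<in> fst d"
  shows "(transition c d has_derivative coord_change c d p) (at (snd c p))"
proof -
  let ?S = "snd c ` (fst c \<inter> fst d)"
  have "open ?S"
    using assms by (simp add: open_overlap_image)
  moreover have "C_k_on 1 (transition c d) ?S"
    using atlas assms unfolding smooth_atlas_def by blast
  hence "transition c d differentiable_on ?S" by simp
  moreover have "snd c p \<in> ?S" using assms by auto
  ultimately have "transition c d differentiable at (snd c p)"
    by (metis at_within_open differentiable_on_def)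
  then show ?thesis
    by (simp add: coord_change_def frechet_derivative_works[symmetric])
qed

text \<open>
  The cocycle rule is the chain rule for the changes of coordinates. It makes \<open>coord\<close> and
  \<open>uncoord\<close> inverse to each other, whatever charts \<open>chart_at\<close> has picked.
\<close>

lemma coord_change_compose:
  assumes "c \<in> A" "d \<in> A" "e \<in> A" "p \<in> fst c" "p \<in> fst d" "p \<in> fst e"
  shows "coord_change d e p (coord_change c d p v) = coord_change c e p v"
proof -
  let ?S = "snd c ` (fst c \<inter> fst d)"
  have "open ?S"
    using assms by (simp add: open_overlap_image)
  have "snd c p \<in> ?S" using assms by simp
  have tp: "transition c d (snd c p) = snd d p"
    using assms by (simp add: transition_def chart_inv_chart)
  have "(transition d e \<circ> transition c d has_derivative coord_change d e p \<circ> coord_change c d p)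
          (at (snd c p))"
    using assms transition_has_derivative[of c d p] transition_has_derivative[of d e p]
    by (intro diff_chain_at) (auto simp: tp)
  moreover have "(transition d e \<circ> transition c d) y = transition c e y" if "y \<in> ?S" for y
    using that assms by (auto simp: transition_def chart_inv_chart)
  ultimately have "(transition c e has_derivative coord_change d e p \<circ> coord_change c d p)
          (at (snd c p))"
    by (rule has_derivative_transform_within_open[OF _ \<open>open ?S\<close> \<open>snd c p \<in> ?S\<close>])
  from has_derivative_unique[OF this transition_has_derivative[OF assms(1,3,4,6)]] show ?thesis
    by (metis comp_apply)
qed

lemma coord_change_self [simp]:
  assumes "c \<in> A" "p \<in> fst c"
  shows "coord_change c c p v = v"
proof -
  have "(transition c c has_derivative id) (at (snd c p))"
  proof (rule has_derivative_transform_within_open[OF has_derivative_id[unfolded id_def[symmetric]] open_chart_image])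
    show "id y = transition c c y" if "y \<in> snd c ` fst c" for y
      using assms that by (simp add: transition_def chart_chart_inv)
  qed (use assms in simp_all)
  from has_derivative_unique[OF this transition_has_derivative[OF assms(1,1,2,2)]] show ?thesis
    by (metis id_apply)
qed

lemma linear_coord_change:
  "c \<in> A \<Longrightarrow> d \<in> A \<Longrightarrow> p \<in> fst c \<Longrightarrow> p \<in> fst d \<Longrightarrow> linear (coord_change c d p)"
  using transition_has_derivative has_derivative_linear by blast

lemma linear_coord: "c \<in> A \<Longrightarrow> p \<in> fst c \<Longrightarrow> linear (coord A c p)"
  and linear_uncoord: "c \<in> A \<Longrightarrow> p \<in> fst c \<Longrightarrow> linear (uncoord A c p)"
  by (auto simp: coord_def uncoord_def linear_coord_change)

lemma coord_uncoord [simp]: "c \<in> A \<Longrightarrow> p \<in> fst c \<Longrightarrow> coord A c p (uncoord A c p v) = v"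
  and uncoord_coord [simp]: "c \<in> A \<Longrightarrow> p \<in> fst c \<Longrightarrow> uncoord A c p (coord A c p v) = v"
  by (auto simp: coord_def uncoord_def coord_change_compose)

lemma coord_uncoord_change:
  "c \<in> A \<Longrightarrow> d \<in> A \<Longrightarrow> p \<in> fst c \<Longrightarrow> p \<in> fst d \<Longrightarrow>
     coord A d p (uncoord A c p v) = coord_change c d p v"
  by (auto simp: coord_def uncoord_def coord_change_compose)

lemma coord_inject: "c \<in> A \<Longrightarrow> p \<in> fst c \<Longrightarrow> coord A c p v = coord A c p w \<longleftrightarrow> v = w"
  by (metis uncoord_coord)

lemma continuous_on_coord_change:
  assumes "c \<in> A" "d \<in> A"
  shows "continuous_on (fst c \<inter> fst d) (\<lambda>p. coord_change c d p v)"
proof -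
  have "C_k_on 1 (transition c d) (snd c ` (fst c \<inter> fst d))"
    using atlas assms unfolding smooth_atlas_def by blast
  hence "continuous_on (snd c ` (fst c \<inter> fst d))
           (\<lambda>y. frechet_derivative (transition c d) (at y) v)"
    by simp
  moreover have "continuous_on (fst c \<inter> fst d) (snd c)"
    using continuous_on_chart[OF assms(1)] by (rule continuous_on_subset) auto
  ultimately show ?thesis
    unfolding coord_change_def by (rule continuous_on_compose2) auto
qed

section \<open>Tangent maps in coordinates\<close>

text \<open>
  The definition of \<open>tangent_map\<close> uses the charts singled out at the two end points, which
  vary discontinuously. In coordinates, any pair of charts may be used instead.
\<close>

lemma coord_tangent_map:
  assumes h: "continuous_on UNIV h" and c: "c \<in> A" "p \<in> fst c" and d: "d \<in> A" "h p \<in> fst d"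
    and D: "(snd d \<circ> h \<circ> chart_inv c has_derivative D) (at (snd c p))"
  shows "coord A d (h p) (tangent_map A h p v) = D (coord A c p v)"
proof -
  define c0 where "c0 = chart_at A p"
  define d0 where "d0 = chart_at A (h p)"
  have c0: "c0 \<in> A" "p \<in> fst c0" and d0: "d0 \<in> A" "h p \<in> fst d0"
    by (simp_all add: c0_def d0_def)
  define U where "U = fst c0 \<inter> fst c \<inter> h -` fst d"
  have "open (h -` fst d)"
    by (rule open_vimage[OF open_chart_domain[OF d(1)] h])
  then have "open (snd c0 ` U)"
    unfolding U_def using open_chart_domain c0 c by (intro open_chart_image_subset open_Int) auto
  have "snd c0 p \<in> snd c0 ` U" using c0 c d by (auto simp: U_def)
  have t: "transition c0 c (snd c0 p) = snd c p"
    using c0 c by (simp add: transition_def chart_inv_chart)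
  have "(transition d d0 \<circ> ((snd d \<circ> h \<circ> chart_inv c) \<circ> transition c0 c) has_derivative
          coord_change d d0 (h p) \<circ> (D \<circ> coord_change c0 c p)) (at (snd c0 p))"
    using c0 c d d0 D transition_has_derivative[of c0 c p] transition_has_derivative[of d d0 "h p"]
    by (intro diff_chain_at) (auto simp: t chart_inv_chart)
  moreover have "(transition d d0 \<circ> ((snd d \<circ> h \<circ> chart_inv c) \<circ> transition c0 c)) y
      = (snd d0 \<circ> h \<circ> chart_inv c0) y" if "y \<in> snd c0 ` U" for y
    using that c0 c d by (auto simp: U_def transition_def chart_inv_chart)
  ultimately have "(snd d0 \<circ> h \<circ> chart_inv c0 has_derivative
          coord_change d d0 (h p) \<circ> (D \<circ> coord_change c0 c p)) (at (snd c0 p))"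
    by (rule has_derivative_transform_within_open
        [OF _ \<open>open (snd c0 ` U)\<close> \<open>snd c0 p \<in> snd c0 ` U\<close>])
  then have "tangent_map A h p = coord_change d d0 (h p) \<circ> (D \<circ> coord_change c0 c p)"
    unfolding tangent_map_def c0_def d0_def by (metis frechet_derivative_at)
  then show ?thesis
    using d d0 by (simp add: coord_def c0_def [symmetric] d0_def [symmetric] coord_change_compose)
qed

end


section \<open>Derivatives of the flow\<close>

locale flow_on_manifold = smooth_manifold A for A :: "'a::t2_space chart set" +
  fixes X :: "'a \<Rightarrow> vec3" and \<phi> :: "real \<Rightarrow> 'a \<Rightarrow> 'a"
  assumes flow: "C1_flow A \<phi>" and generator: "generates A X \<phi>"
    and continuous_generator: "continuous_field_on A UNIV X"
begin

lemma flow_0 [simp]: "\<phi> 0 p = p"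
  and flow_add: "\<phi> (s + t) p = \<phi> s (\<phi> t p)"
  and continuous_flow: "continuous_on UNIV (\<lambda>(t, p). \<phi> t p)"
  using flow by (simp_all add: C1_flow_def)

lemma flow_minus [simp]: "\<phi> (- t) (\<phi> t p) = p"
  using flow_add[of "- t" t p] by simp

lemma continuous_on_time_map: "continuous_on UNIV (\<phi> t)"
  using continuous_on_compose2[OF continuous_flow, of UNIV "Pair t"]
  by (simp add: continuous_on_Pair)

lemma continuous_on_flow [continuous_intros]:
  assumes "continuous_on S f" "continuous_on S g"
  shows "continuous_on S (\<lambda>x. \<phi> (f x) (g x))"
  using continuous_on_compose2[OF continuous_flow continuous_on_Pair[OF assms]] by simp

text \<open>
  The local representative is taken in time and space jointly: continuity of its derivative
  in both variables is what later allows integration over time of quantities that stay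
  continuous in the base point.
\<close>

definition flow_chart :: "'a chart \<Rightarrow> 'a chart \<Rightarrow> real \<times> vec3 \<Rightarrow> vec3" where
  "flow_chart c d = (\<lambda>(t, y). snd d (\<phi> t (chart_inv c y)))"

definition flow_chart_domain :: "'a chart \<Rightarrow> 'a chart \<Rightarrow> (real \<times> vec3) set" where
  "flow_chart_domain c d = {(t, y). y \<in> snd c ` fst c \<and> \<phi> t (chart_inv c y) \<in> fst d}"

definition flow_coord :: "'a chart \<Rightarrow> 'a chart \<Rightarrow> real \<Rightarrow> 'a \<Rightarrow> vec3 \<Rightarrow> vec3" where
  "flow_coord c d t p v = frechet_derivative (flow_chart c d) (at (t, snd c p)) (0, v)"

abbreviation dflow :: "real \<Rightarrow> 'a \<Rightarrow> vec3 \<Rightarrow> vec3" where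
  "dflow t p \<equiv> tangent_map A (\<phi> t) p"

lemma open_flow_chart_domain:
  assumes "c \<in> A" "d \<in> A"
  shows "open (flow_chart_domain c d)"
proof -
  let ?f = "\<lambda>z. \<phi> (fst z) (chart_inv c (snd z))"
  have "continuous_on (UNIV \<times> snd c ` fst c) (\<lambda>z. chart_inv c (snd z))"
    by (rule continuous_on_compose2[OF continuous_on_chart_inv[OF assms(1)]])
       (auto intro: continuous_intros)
  then have "continuous_on (UNIV \<times> snd c ` fst c) ?f"
    by (intro continuous_intros)
  then have "open ((UNIV \<times> snd c ` fst c) \<inter> ?f -` fst d)"
    using assms by (intro continuous_open_preimage open_Times open_UNIV open_chart_image open_chart_domain)
  moreover have "flow_chart_domain c d = (UNIV \<times> snd c ` fst c) \<inter> ?f -` fst d"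
    by (auto simp: flow_chart_domain_def)
  ultimately show ?thesis by simp
qed

lemma flow_chart_C1:
  assumes "c \<in> A" "d \<in> A"
  shows "flow_chart c d differentiable_on flow_chart_domain c d"
    and "continuous_on (flow_chart_domain c d) (\<lambda>z. frechet_derivative (flow_chart c d) (at z) w)"
proof -
  have "C_k_on 1 (flow_chart c d) (flow_chart_domain c d)"
    using flow assms unfolding C1_flow_def flow_chart_def flow_chart_domain_def by blast
  then show "flow_chart c d differentiable_on flow_chart_domain c d"
    "continuous_on (flow_chart_domain c d) (\<lambda>z. frechet_derivative (flow_chart c d) (at z) w)"
    unfolding One_nat_def C_k_on.simps by blast+
qed

lemma flow_has_derivative_in_charts:
  assumes "c \<in> A" "d \<in> A" "p \<in> fst c" "\<phi> t p \<in> fst d"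
  shows "(snd d \<circ> \<phi> t \<circ> chart_inv c has_derivative flow_coord c d t p) (at (snd c p))"
proof -
  let ?z = "(t, snd c p)"
  have "?z \<in> flow_chart_domain c d"
    using assms by (simp add: flow_chart_domain_def chart_inv_chart)
  then have "flow_chart c d differentiable at ?z"
    using flow_chart_C1(1) open_flow_chart_domain assms
    by (metis at_within_open differentiable_on_def)
  then have *: "(flow_chart c d has_derivative frechet_derivative (flow_chart c d) (at ?z)) (at ?z)"
    by (simp add: frechet_derivative_works)
  have "(flow_chart c d \<circ> Pair t has_derivative
          frechet_derivative (flow_chart c d) (at ?z) \<circ> (\<lambda>v. (0, v))) (at (snd c p))"
    by (intro diff_chain_at * has_derivative_Pair has_derivative_const has_derivative_ident)
  moreover have "flow_chart c d \<circ> Pair t = snd d \<circ> \<phi> t \<circ> chart_inv c"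
    by (auto simp: flow_chart_def)
  moreover have "frechet_derivative (flow_chart c d) (at ?z) \<circ> (\<lambda>v. (0, v)) = flow_coord c d t p"
    by (auto simp: flow_coord_def)
  ultimately show ?thesis by simp
qed

lemma coord_dflow:
  assumes "c \<in> A" "d \<in> A" "p \<in> fst c" "\<phi> t p \<in> fst d"
  shows "coord A d (\<phi> t p) (dflow t p v) = flow_coord c d t p (coord A c p v)"
  using assms by (intro coord_tangent_map flow_has_derivative_in_charts continuous_on_time_map)

lemma linear_flow_coord:
  assumes "c \<in> A" "d \<in> A" "p \<in> fst c" "\<phi> t p \<in> fst d"
  shows "linear (flow_coord c d t p)"
  using flow_has_derivative_in_charts[OF assms] has_derivative_linear by blast

lemma linear_dflow: "linear (dflow t p)"
proof -
  let ?c = "chart_at A p" and ?d = "chart_at A (\<phi> t p)"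
  have "dflow t p = uncoord A ?d (\<phi> t p) \<circ> (flow_coord ?c ?d t p \<circ> coord A ?c p)"
    by (auto simp: coord_dflow[of ?c ?d, symmetric])
  moreover have "linear (uncoord A ?d (\<phi> t p) \<circ> (flow_coord ?c ?d t p \<circ> coord A ?c p))"
    by (intro linear_compose linear_coord linear_uncoord linear_flow_coord) simp_all
  ultimately show ?thesis by simp
qed

lemma dflow_add: "dflow (s + t) p v = dflow s (\<phi> t p) (dflow t p v)"
proof -
  let ?c = "chart_at A p" and ?d = "chart_at A (\<phi> t p)" and ?e = "chart_at A (\<phi> (s + t) p)"
  define U where "U = {y. (t, y) \<in> flow_chart_domain ?c ?d}"
  have "U = Pair t -` flow_chart_domain ?c ?d" by (auto simp: U_def)
  also have "open \<dots>"
    by (intro open_vimage open_flow_chart_domain continuous_intros) simp_all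
  finally have "open U" .
  have "snd ?c p \<in> U" by (simp add: U_def flow_chart_domain_def chart_inv_chart)
  have "(snd ?e \<circ> \<phi> s \<circ> chart_inv ?d has_derivative flow_coord ?d ?e s (\<phi> t p)) 
          (at (snd ?d (\<phi> t p)))"
    by (intro flow_has_derivative_in_charts) (simp_all add: flow_add[symmetric])
  moreover have "(snd ?d \<circ> \<phi> t \<circ> chart_inv ?c has_derivative flow_coord ?c ?d t p) (at (snd ?c p))"
    by (intro flow_has_derivative_in_charts) simp_all
  moreover have "snd ?d (\<phi> t p) = (snd ?d \<circ> \<phi> t \<circ> chart_inv ?c) (snd ?c p)"
    by (simp add: chart_inv_chart)
  ultimately have "((snd ?e \<circ> \<phi> s \<circ> chart_inv ?d) \<circ> (snd ?d \<circ> \<phi> t \<circ> chart_inv ?c) has_derivative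
          flow_coord ?d ?e s (\<phi> t p) \<circ> flow_coord ?c ?d t p) (at (snd ?c p))"
    by (intro diff_chain_at) simp_all
  then have D: "(snd ?e \<circ> \<phi> (s + t) \<circ> chart_inv ?c has_derivative
          flow_coord ?d ?e s (\<phi> t p) \<circ> flow_coord ?c ?d t p) (at (snd ?c p))"
  proof (rule has_derivative_transform_within_open[OF _ \<open>open U\<close> \<open>snd ?c p \<in> U\<close>])
    fix y assume "y \<in> U"
    then show "((snd ?e \<circ> \<phi> s \<circ> chart_inv ?d) \<circ> (snd ?d \<circ> \<phi> t \<circ> chart_inv ?c)) y
      = (snd ?e \<circ> \<phi> (s + t) \<circ> chart_inv ?c) y"
      by (simp add: U_def flow_chart_domain_def chart_inv_chart flow_add)
  qed
  have "coord A ?e (\<phi> (s + t) p) (dflow (s + t) p v)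
      = (flow_coord ?d ?e s (\<phi> t p) \<circ> flow_coord ?c ?d t p) (coord A ?c p v)"
    by (rule coord_tangent_map[OF continuous_on_time_map _ _ _ _ D]) simp_all
  also have "\<dots> = flow_coord ?d ?e s (\<phi> t p) (coord A ?d (\<phi> t p) (dflow t p v))"
    by (simp add: coord_dflow[of ?c ?d])
  also have "\<dots> = coord A ?e (\<phi> s (\<phi> t p)) (dflow s (\<phi> t p) (dflow t p v))"
    by (rule coord_dflow[symmetric]) (simp_all add: flow_add[symmetric])
  finally show ?thesis
    using coord_inject[of ?e "\<phi> (s + t) p"] by (simp add: flow_add[symmetric])
qed

lemma dflow_0 [simp]: "dflow 0 p v = v"
proof -
  let ?c = "chart_at A p"
  have D: "(snd ?c \<circ> \<phi> 0 \<circ> chart_inv ?c has_derivative id) (at (snd ?c p))"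
  proof (rule has_derivative_transform_within_open
      [OF has_derivative_id[unfolded id_def[symmetric]] open_chart_image])
    show "id y = (snd ?c \<circ> \<phi> 0 \<circ> chart_inv ?c) y" if "y \<in> snd ?c ` fst ?c" for y
      using that by (simp add: chart_chart_inv)
  qed simp_all
  have "coord A ?c (\<phi> 0 p) (dflow 0 p v) = id (coord A ?c p v)"
    by (rule coord_tangent_map[OF continuous_on_time_map _ _ _ _ D]) simp_all
  then show ?thesis by (simp add: coord_inject)
qed

text \<open>
  The time \<open>t\<close> map sends the orbit of \<open>p\<close> to itself with the time parameter shifted by \<open>t\<close>;
  comparing the velocities at \<open>p\<close> and at \<open>\<phi> t p\<close> shows that the flow preserves its generator.
\<close>

lemma dflow_generator: "dflow t p (X p) = X (\<phi> t p)"
proof -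
  let ?c = "chart_at A p" and ?d = "chart_at A (\<phi> t p)"
  define U where "U = (\<lambda>s. \<phi> s p) -` fst ?c"
  have "open U" unfolding U_def
    by (intro open_vimage open_chart_domain continuous_intros) simp_all
  have "0 \<in> U" by (simp add: U_def)
  have "((\<lambda>s. snd ?c (\<phi> s p)) has_vector_derivative coord A ?c (\<phi> 0 p) (X (\<phi> 0 p))) (at 0)"
    using generator unfolding generates_def by (metis chart_at_simps flow_0)
  moreover have "(snd ?d \<circ> \<phi> t \<circ> chart_inv ?c has_derivative flow_coord ?c ?d t p) 
      (at (snd ?c (\<phi> 0 p)))"
    using flow_has_derivative_in_charts[of ?c ?d p t] by simp
  ultimately have "((snd ?d \<circ> \<phi> t \<circ> chart_inv ?c) \<circ> (\<lambda>s. snd ?c (\<phi> s p)) has_vector_derivative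
      flow_coord ?c ?d t p (coord A ?c p (X p))) (at 0)"
    using vector_derivative_diff_chain_within
      [of "\<lambda>s. snd ?c (\<phi> s p)" _ 0 UNIV "snd ?d \<circ> \<phi> t \<circ> chart_inv ?c" "flow_coord ?c ?d t p"]
    by (simp add: has_derivative_at_withinI)
  then have "((\<lambda>s. snd ?d (\<phi> (s + t) p)) has_vector_derivative
      flow_coord ?c ?d t p (coord A ?c p (X p))) (at 0)"
  proof (rule has_vector_derivative_transform_within_open[OF _ \<open>open U\<close> \<open>0 \<in> U\<close>])
    fix s assume "s \<in> U"
    then show "((snd ?d \<circ> \<phi> t \<circ> chart_inv ?c) \<circ> (\<lambda>s. snd ?c (\<phi> s p))) s = snd ?d (\<phi> (s + t) p)"
      by (simp add: U_def chart_inv_chart flow_add[symmetric] add.commute)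
  qed
  moreover have "((\<lambda>s. snd ?d (\<phi> (s + t) p)) has_vector_derivative coord A ?d (\<phi> t p) (X (\<phi> t p))) (at 0)"
  proof -
    have "((\<lambda>s. snd ?d (\<phi> s p)) has_vector_derivative coord A ?d (\<phi> t p) (X (\<phi> t p))) (at (0 + t))"
      using generator unfolding generates_def by simp
    moreover have "((\<lambda>s. s + t) has_vector_derivative 1) (at 0)"
      by (auto intro!: derivative_eq_intros)
    ultimately show ?thesis
      using vector_diff_chain_at[of "\<lambda>s. s + t" 1 0] by (simp add: o_def)
  qed
  ultimately have "coord A ?d (\<phi> t p) (X (\<phi> t p)) = flow_coord ?c ?d t p (coord A ?c p (X p))"
    using vector_derivative_unique_at by blast
  also have "\<dots> = coord A ?d (\<phi> t p) (dflow t p (X p))"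
    by (simp add: coord_dflow[of ?c ?d])
  finally show ?thesis by (simp add: coord_inject)
qed

lemma continuous_on_flow_coord:
  assumes "c \<in> A" "d \<in> A"
  shows "continuous_on {(p, t). p \<in> fst c \<and> \<phi> t p \<in> fst d} (\<lambda>(p, t). flow_coord c d t p v)"
proof -
  let ?S = "{(p, t). p \<in> fst c \<and> \<phi> t p \<in> fst d}"
  have "continuous_on ?S (\<lambda>z. snd c (fst z))"
    by (rule continuous_on_compose2[OF continuous_on_chart[OF assms(1)]])
       (auto intro: continuous_intros)
  then have "continuous_on ?S (\<lambda>z. (snd z, snd c (fst z)))"
    by (intro continuous_intros)
  then have "continuous_on ?S
      (\<lambda>z. frechet_derivative (flow_chart c d) (at (snd z, snd c (fst z))) (0, v))"
    by (rule continuous_on_compose2[OF flow_chart_C1(2)[OF assms]])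
       (auto simp: flow_chart_domain_def chart_inv_chart[OF assms(1)])
  then show ?thesis by (simp add: flow_coord_def case_prod_unfold)
qed

end


section \<open>Continuous 1-forms\<close>

lemma integral_mean_value:
  fixes h :: "real \<Rightarrow> real"
  assumes "continuous_on {0..1} h"
  obtains s where "s \<in> {0..1}" "integral {0..1} h = h s"
proof -
  have "((\<lambda>u. integral {0..u} h) has_derivative (\<lambda>u. u * h x)) (at x within {0..1})"
    if "0 \<le> x" "x \<le> 1" for x
    using integral_has_vector_derivative[OF assms, of x] that by (simp add: has_vector_derivative_def)
  from mvt_very_simple[OF zero_le_one this] obtain s where
    "s \<in> {0..1}" "integral {0..1} h - integral {0..0} h = (1 - 0) * h s" by blast
  with that show ?thesis by simp
qed

text \<open>
  Averaging over a unit time interval gains one derivative along the flow: shifting the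
  starting time only moves the end points of the interval.
\<close>

lemma sliding_integral_has_derivative:
  fixes h :: "real \<Rightarrow> real"
  assumes "continuous_on UNIV h"
  shows "((\<lambda>t. integral {0..1} (\<lambda>s. h (s + t))) has_real_derivative h 1 - h 0) (at 0)"
proof -
  \<comment> \<open>The base point \<open>-2\<close> keeps all times \<open>s + t\<close> with \<open>s\<close> in \<open>{0..1}\<close> and \<open>t\<close> near \<open>0\<close>
    inside the interval where \<open>H\<close> is an antiderivative.\<close>
  define H where "H x = integral {-2..x} h" for x
  have H: "(H has_real_derivative h x) (at x)" if "x \<in> {-2<..<3}" for x
  proof -
    have "(H has_real_derivative h x) (at x within {-2..3})"
      unfolding H_def
      by (rule integral_has_real_derivative) (use assms that continuous_on_subset in auto)
    then show ?thesis
      using that at_within_Icc_at[of "-2" x 3] by simp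
  qed
  have "((\<lambda>t. H (1 + t) - H t) has_real_derivative h (1 + 0) * (0 + 1) - h 0) (at 0)"
    by (intro DERIV_diff DERIV_chain2[where f = H] H derivative_intros) auto
  moreover have "H (1 + t) - H t = integral {0..1} (\<lambda>s. h (s + t))" if "t \<in> {-1<..<1}" for t
  proof -
    have "((\<lambda>s. h (s + t)) has_integral H (1 + t) - H (0 + t)) {0..1}"
    proof (rule fundamental_theorem_of_calculus)
      fix s :: real assume "s \<in> {0..1}"
      then have "((\<lambda>s. H (s + t)) has_real_derivative h (s + t) * (1 + 0)) (at s)"
        using that by (intro DERIV_chain2[where f = H] H derivative_intros) auto
      then show "((\<lambda>s. H (s + t)) has_vector_derivative h (s + t)) (at s within {0..1})"
        by (simp add: has_real_derivative_iff_has_vector_derivative has_vector_derivative_at_within)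
    qed simp
    then show ?thesis by (simp add: integral_unique)
  qed
  ultimately show ?thesis
    using has_field_derivative_transform_within_open[of "\<lambda>t. H (1 + t) - H t" "h 1 - h 0" 0 "{-1<..<1}"]
    by simp
qed

text \<open>
  A fibrewise linear function is determined by its values on the standard basis, so its
  continuity only has to be known for constant vectors. The base \<open>'b\<close> is arbitrary because
  the lemma serves both for points of the manifold and for pairs of a point and a time.
\<close>

lemma continuous_on_linear_apply:
  fixes L :: "'b::topological_space \<Rightarrow> vec3 \<Rightarrow> real"
  assumes L: "\<And>x. x \<in> S \<Longrightarrow> linear (L x)" and c: "\<And>v. continuous_on S (\<lambda>x. L x v)"
    and Y: "continuous_on S Y"
  shows "continuous_on S (\<lambda>x. L x (Y x))"
proof -
  have "L x (Y x) = (\<Sum>i\<in>UNIV. Y x $ i * L x (axis i 1))" if "x \<in> S" for x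
  proof -
    have "L x (Y x) = L x (\<Sum>i\<in>UNIV. (Y x $ i) *\<^sub>R axis i 1)"
      using basis_expansion[of "Y x"] by (simp add: scalar_mult_eq_scaleR)
    also have "\<dots> = (\<Sum>i\<in>UNIV. Y x $ i * L x (axis i 1))"
      using L[OF that] by (simp add: linear_sum linear_cmul)
    finally show ?thesis .
  qed
  moreover have "continuous_on S (\<lambda>x. \<Sum>i\<in>UNIV. Y x $ i * L x (axis i 1))"
    by (intro continuous_intros c Y)
  ultimately show ?thesis by (simp cong: continuous_on_cong)
qed

context smooth_manifold
begin

definition continuous_1form :: "('a \<Rightarrow> vec3 \<Rightarrow> real) \<Rightarrow> bool" where
  "continuous_1form \<alpha> \<longleftrightarrow>
     (\<forall>p. linear (\<alpha> p)) \<and> (\<forall>c\<in>A. \<forall>v. continuous_on (fst c) (\<lambda>p. \<alpha> p (uncoord A c p v)))"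

lemma linear_1form: "continuous_1form \<alpha> \<Longrightarrow> linear (\<alpha> p)"
  by (simp add: continuous_1form_def)

lemma continuous_on_chart_cover:
  assumes "open V" "\<And>c. c \<in> A \<Longrightarrow> continuous_on (V \<inter> fst c) f"
  shows "continuous_on V f"
proof -
  have "V = (\<Union>c\<in>A. V \<inter> fst c)"
    using atlas unfolding smooth_atlas_def by blast
  moreover have "continuous_on (\<Union>c\<in>A. V \<inter> fst c) f"
    using assms open_chart_domain by (intro continuous_on_open_UN) auto
  ultimately show ?thesis by simp
qed

lemma continuous_on_1form_field:
  assumes \<alpha>: "continuous_1form \<alpha>" and "open V" and Y: "continuous_field_on A V Y"
  shows "continuous_on V (\<lambda>p. \<alpha> p (Y p))"
proof (rule continuous_on_chart_cover[OF \<open>open V\<close>])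
  fix c assume c: "c \<in> A"
  have "continuous_on (V \<inter> fst c) (\<lambda>p. \<alpha> p (uncoord A c p (coord A c p (Y p))))"
  proof (rule continuous_on_linear_apply
      [of _ "\<lambda>p v. \<alpha> p (uncoord A c p v)" "\<lambda>p. coord A c p (Y p)"])
    show "linear (\<lambda>v. \<alpha> p (uncoord A c p v))" if "p \<in> V \<inter> fst c" for p
      using linear_compose[OF linear_uncoord[OF c] linear_1form[OF \<alpha>]] that by (simp add: o_def)
    show "continuous_on (V \<inter> fst c) (\<lambda>p. \<alpha> p (uncoord A c p v))" for v
      using \<alpha> c unfolding continuous_1form_def by (meson continuous_on_subset inf_le2)
    show "continuous_on (V \<inter> fst c) (\<lambda>p. coord A c p (Y p))"
      using Y c by (simp add: continuous_field_on_def)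
  qed
  then show "continuous_on (V \<inter> fst c) (\<lambda>p. \<alpha> p (Y p))"
    by (rule continuous_on_eq) (use c in simp)
qed

lemma continuous_field_on_subset:
  "continuous_field_on A V Y \<Longrightarrow> W \<subseteq> V \<Longrightarrow> continuous_field_on A W Y"
  unfolding continuous_field_on_def by (meson Int_mono continuous_on_subset order_refl)

lemma continuous_field_on_uncoord:
  assumes "c \<in> A"
  shows "continuous_field_on A (fst c) (\<lambda>p. uncoord A c p v)"
  unfolding continuous_field_on_def
proof
  fix d assume d: "d \<in> A"
  show "continuous_on (fst c \<inter> fst d) (\<lambda>p. coord A d p (uncoord A c p v))"
    by (rule continuous_on_eq[OF continuous_on_coord_change[OF assms d, of v]])
       (simp add: coord_uncoord_change assms d)
qed

text \<open>
  Cutting off at a set \<open>K\<close> that is closed in the whole manifold, not only in the chart, is what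
  makes the extension by zero of a locally defined form continuous. Closedness of \<open>K\<close> holds
  because \<open>K\<close> is a compact set in a Hausdorff space.
\<close>

lemma exists_bump:
  fixes p :: 'a
  assumes c: "c \<in> A" "p \<in> fst c"
  obtains \<eta> :: "'a \<Rightarrow> real" and K where
    "continuous_on (fst c) \<eta>" "closed K" "K \<subseteq> fst c" "\<And>q. q \<notin> K \<Longrightarrow> \<eta> q = 0"
    "\<And>q. \<eta> q \<ge> 0" "\<eta> p > 0"
proof -
  obtain r where r: "r > 0" "cball (snd c p) r \<subseteq> snd c ` fst c"
    using open_contains_cball[of "snd c ` fst c"] open_chart_image c by blast
  define K where "K = chart_inv c ` cball (snd c p) r"
  define \<eta> where "\<eta> q = (if q \<in> fst c then max 0 (r - dist (snd c p) (snd c q)) else 0)" for q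
  show ?thesis
  proof
    have "compact K"
      unfolding K_def
      using continuous_on_chart_inv[OF c(1)] r(2) by (intro compact_continuous_image)
        (auto intro: continuous_on_subset)
    then show "closed K" by (rule compact_imp_closed)
    show "K \<subseteq> fst c"
      unfolding K_def using chart_inv_in_domain[OF c(1)] r(2) by blast
    have "continuous_on (fst c) (\<lambda>q. max 0 (r - dist (snd c p) (snd c q)))"
      by (intro continuous_intros continuous_on_chart c)
    then show "continuous_on (fst c) \<eta>"
      by (simp add: \<eta>_def cong: continuous_on_cong)
    show "\<eta> q = 0" if "q \<notin> K" for q
    proof (rule ccontr)
      assume "\<eta> q \<noteq> 0"
      then have "q \<in> fst c" "snd c q \<in> cball (snd c p) r"
        by (auto simp: \<eta>_def split: if_splits)
      then have "q \<in> K"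
        unfolding K_def using chart_inv_chart[OF c(1)] by (metis imageI)
      with that show False by simp
    qed
    show "\<eta> p > 0" using c r by (simp add: \<eta>_def)
  qed (simp add: \<eta>_def)
qed

lemma exists_local_1form:
  assumes X: "continuous_field_on A UNIV X" "X p \<noteq> 0"
  obtains \<omega> where "continuous_1form \<omega>" "\<And>q. \<omega> q (X q) \<ge> 0" "\<omega> p (X p) > 0"
proof -
  let ?c = "chart_at A p"
  obtain \<eta> :: "'a \<Rightarrow> real" and K where \<eta>: "continuous_on (fst ?c) \<eta>" "closed K" "K \<subseteq> fst ?c"
      "\<And>q. q \<notin> K \<Longrightarrow> \<eta> q = 0" "\<And>q. \<eta> q \<ge> 0" "\<eta> p > 0"
    by (rule exists_bump[of ?c p, OF chart_at_simps]) blast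
  define \<omega> where "\<omega> q v = (if q \<in> K then \<eta> q * (coord A ?c q (X q) \<bullet> coord A ?c q v) else 0)" for q v
  have "linear (\<omega> q)" for q
  proof (cases "q \<in> K")
    case True
    then have l: "linear (coord A ?c q)" using \<eta> by (intro linear_coord) auto
    show ?thesis
      using True by (intro linearI)
        (simp_all add: \<omega>_def linear_add[OF l] linear_cmul[OF l] algebra_simps inner_add_right)
  next
    case False
    then show ?thesis by (intro linearI) (simp_all add: \<omega>_def)
  qed
  moreover have "continuous_on (fst d) (\<lambda>q. \<omega> q (uncoord A d q v))" if d: "d \<in> A" for d v
  proof -
    have "continuous_on (fst d \<inter> fst ?c)
        (\<lambda>q. \<eta> q * (coord A ?c q (X q) \<bullet> coord A ?c q (uncoord A d q v)))"
    proof (intro continuous_intros)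
      show "continuous_on (fst d \<inter> fst ?c) \<eta>"
        using \<eta>(1) by (rule continuous_on_subset) simp
      show "continuous_on (fst d \<inter> fst ?c) (\<lambda>q. coord A ?c q (X q))"
        using continuous_field_on_subset[OF X(1), of "fst d"] by (simp add: continuous_field_on_def)
      show "continuous_on (fst d \<inter> fst ?c) (\<lambda>q. coord A ?c q (uncoord A d q v))"
        using continuous_field_on_uncoord[OF d] by (simp add: continuous_field_on_def)
    qed
    then have 1: "continuous_on (fst d \<inter> fst ?c) (\<lambda>q. \<omega> q (uncoord A d q v))"
      by (rule continuous_on_eq) (auto simp: \<omega>_def \<eta>(4))
    have 2: "continuous_on (fst d - K) (\<lambda>q. \<omega> q (uncoord A d q v))"
      by (rule continuous_on_eq[OF continuous_on_const[of _ 0]]) (simp add: \<omega>_def)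
    have "continuous_on ((fst d \<inter> fst ?c) \<union> (fst d - K)) (\<lambda>q. \<omega> q (uncoord A d q v))"
      using 1 2 d \<eta>(2) by (intro continuous_on_open_Un open_Int open_Diff open_chart_domain) simp_all
    moreover have "(fst d \<inter> fst ?c) \<union> (fst d - K) = fst d" using \<eta>(3) by auto
    ultimately show ?thesis by simp
  qed
  ultimately have "continuous_1form \<omega>" by (simp add: continuous_1form_def)
  moreover have "\<omega> q (X q) \<ge> 0" for q using \<eta>(5) by (simp add: \<omega>_def)
  moreover have "\<omega> p (X p) > 0"
  proof -
    have "p \<in> K" using \<eta>(4,6) by fastforce
    have "coord A ?c p (X p) \<noteq> coord A ?c p 0"
      using X(2) by (simp add: coord_inject)
    then have "coord A ?c p (X p) \<noteq> 0"
      using linear_0[OF linear_coord[of ?c p]] by simp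
    then show ?thesis using \<open>p \<in> K\<close> \<eta>(6) by (simp add: \<omega>_def)
  qed
  ultimately show ?thesis by (rule that)
qed

text \<open>
  The forms that are nonnegative on \<open>X\<close> are closed under sums, so finitely many local ones,
  whose regions of positivity cover the compact manifold, add up to a form that is positive
  on \<open>X\<close> everywhere. Dividing by that value normalises it.
\<close>

lemma exists_1form_normalized_on_field:
  assumes "compact (UNIV :: 'a set)" and X: "continuous_field_on A UNIV X" "\<And>p. X p \<noteq> 0"
  obtains \<alpha> where "continuous_1form \<alpha>" "\<And>p. \<alpha> p (X p) = 1"
proof -
  have "\<exists>\<omega>. continuous_1form \<omega> \<and> (\<forall>q. \<omega> q (X q) \<ge> 0) \<and> \<omega> p (X p) > 0" for p
    by (rule exists_local_1form[OF X, of p]) blast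
  then obtain \<omega> where \<omega>: "\<And>p. continuous_1form (\<omega> p)" "\<And>p q. \<omega> p q (X q) \<ge> 0"
      "\<And>p. \<omega> p p (X p) > 0" by metis
  have "open {q. \<omega> p q (X q) > 0}" for p
    using continuous_on_1form_field[OF \<omega>(1) open_UNIV X(1)]
    by (intro open_Collect_less continuous_intros)
  moreover have "UNIV \<subseteq> (\<Union>p. {q. \<omega> p q (X q) > 0})" using \<omega>(3) by blast
  ultimately obtain F where F: "finite F" "UNIV \<subseteq> (\<Union>p\<in>F. {q. \<omega> p q (X q) > 0})"
    by (rule compactE_image[OF assms(1), of UNIV "\<lambda>p. {q. \<omega> p q (X q) > 0}"])
  define \<sigma> where "\<sigma> q v = (\<Sum>p\<in>F. \<omega> p q v)" for q v
  have \<sigma>: "continuous_1form \<sigma>"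
    unfolding continuous_1form_def \<sigma>_def
  proof (intro conjI allI ballI)
    show "linear (\<lambda>v. \<Sum>p\<in>F. \<omega> p q v)" for q
      using \<omega>(1) by (intro linear_compose_sum) (auto simp: linear_1form)
    show "continuous_on (fst c) (\<lambda>q. \<Sum>p\<in>F. \<omega> p q (uncoord A c q v))" if "c \<in> A" for c v
      using \<omega>(1) that by (intro continuous_on_sum) (simp add: continuous_1form_def)
  qed
  have pos: "\<sigma> q (X q) > 0" for q
  proof -
    obtain p where "p \<in> F" "\<omega> p q (X q) > 0" using F(2) by blast
    then show ?thesis unfolding \<sigma>_def using F(1) \<omega>(2) by (intro sum_pos2) auto
  qed
  define \<alpha> where "\<alpha> q v = \<sigma> q v / \<sigma> q (X q)" for q v
  have "continuous_1form \<alpha>"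
    unfolding continuous_1form_def
  proof (intro conjI allI ballI)
    show "linear (\<alpha> q)" for q
      using linear_1form[OF \<sigma>, of q]
      by (intro linearI) (simp_all add: \<alpha>_def linear_add linear_cmul add_divide_distrib)
    show "continuous_on (fst c) (\<lambda>q. \<alpha> q (uncoord A c q v))" if "c \<in> A" for c v
      unfolding \<alpha>_def
    proof (intro continuous_on_divide)
      show "continuous_on (fst c) (\<lambda>q. \<sigma> q (uncoord A c q v))"
        using \<sigma> that by (simp add: continuous_1form_def)
      show "continuous_on (fst c) (\<lambda>q. \<sigma> q (X q))"
        using continuous_on_1form_field[OF \<sigma> open_UNIV X(1)] continuous_on_subset by blast
      show "\<forall>q\<in>fst c. \<sigma> q (X q) \<noteq> 0"
        using pos by (simp add: less_imp_neq[symmetric])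
    qed
  qed
  moreover have "\<alpha> q (X q) = 1" for q using pos[of q] by (simp add: \<alpha>_def)
  ultimately show ?thesis by (rule that)
qed

end

section \<open>Averaging a 1-form along the flow\<close>

context flow_on_manifold
begin

definition flow_average :: "('a \<Rightarrow> vec3 \<Rightarrow> real) \<Rightarrow> 'a \<Rightarrow> vec3 \<Rightarrow> real" where
  "flow_average \<alpha> p v = integral {0..1} (\<lambda>t. \<alpha> (\<phi> t p) (dflow t p v))"

text \<open>
  For each chart \<open>d\<close>, the pairs \<open>(p, t)\<close> for which \<open>\<phi> t p\<close> lies in \<open>d\<close> form an open set, and
  there the function is expressed by the coefficients of \<open>\<alpha>\<close> in \<open>d\<close> and the derivative of the
  flow in coordinates. These sets cover all pairs.
\<close>

lemma continuous_on_1form_dflow: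
  assumes \<alpha>: "continuous_1form \<alpha>" and c: "c \<in> A"
  shows "continuous_on (fst c \<times> UNIV) (\<lambda>(p, t). \<alpha> (\<phi> t p) (dflow t p (uncoord A c p v)))"
proof -
  define S where "S d = {(p, t). p \<in> fst c \<and> \<phi> t p \<in> fst d}" for d :: "'a chart"
  have cover: "fst c \<times> UNIV = (\<Union>d\<in>A. S d)"
    using atlas unfolding smooth_atlas_def S_def by blast
  have flow_pt: "continuous_on S (\<lambda>z. \<phi> (snd z) (fst z))" for S
    by (intro continuous_intros)
  have "open (S d)" if "d \<in> A" for d
  proof -
    have "S d = (fst c \<times> UNIV) \<inter> (\<lambda>z. \<phi> (snd z) (fst z)) -` fst d" by (auto simp: S_def)
    also have "open \<dots>"
      using that c flow_pt
      by (intro open_Int open_Times open_UNIV open_vimage open_chart_domain)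
    finally show ?thesis .
  qed
  moreover have "continuous_on (S d) (\<lambda>(p, t). \<alpha> (\<phi> t p) (dflow t p (uncoord A c p v)))"
    if d: "d \<in> A" for d
  proof -
    have "continuous_on (S d) (\<lambda>z. \<alpha> (\<phi> (snd z) (fst z))
        (uncoord A d (\<phi> (snd z) (fst z)) (case z of (p, t) \<Rightarrow> flow_coord c d t p v)))"
    proof (rule continuous_on_linear_apply
        [of _ "\<lambda>z. \<lambda>w. \<alpha> (\<phi> (snd z) (fst z)) (uncoord A d (\<phi> (snd z) (fst z)) w)"
           "\<lambda>(p, t). flow_coord c d t p v"])
      fix z assume "z \<in> S d"
      then have "\<phi> (snd z) (fst z) \<in> fst d" by (auto simp: S_def)
      from linear_compose[OF linear_uncoord[OF d this] linear_1form[OF \<alpha>]]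
      show "linear (\<lambda>w. \<alpha> (\<phi> (snd z) (fst z)) (uncoord A d (\<phi> (snd z) (fst z)) w))"
        by (simp add: o_def)
    next
      fix w
      have "continuous_on (fst d) (\<lambda>q. \<alpha> q (uncoord A d q w))"
        using \<alpha> d by (simp add: continuous_1form_def)
      then show "continuous_on (S d) (\<lambda>z. \<alpha> (\<phi> (snd z) (fst z)) (uncoord A d (\<phi> (snd z) (fst z)) w))"
        by (rule continuous_on_compose2[OF _ flow_pt]) (auto simp: S_def)
    next
      show "continuous_on (S d) (\<lambda>(p, t). flow_coord c d t p v)"
        unfolding S_def by (rule continuous_on_flow_coord[OF c d])
    qed
    then show ?thesis
    proof (rule continuous_on_eq)
      fix z assume "z \<in> S d"
      then obtain p t where z: "z = (p, t)" "p \<in> fst c" "\<phi> t p \<in> fst d" by (auto simp: S_def)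
      then have "flow_coord c d t p v = coord A d (\<phi> t p) (dflow t p (uncoord A c p v))"
        using c d by (simp add: coord_dflow)
      then show "\<alpha> (\<phi> (snd z) (fst z)) (uncoord A d (\<phi> (snd z) (fst z)) 
            (case z of (p, t) \<Rightarrow> flow_coord c d t p v))
          = (case z of (p, t) \<Rightarrow> \<alpha> (\<phi> t p) (dflow t p (uncoord A c p v)))"
        using z d by simp
    qed
  qed
  ultimately show ?thesis
    unfolding cover by (intro continuous_on_open_UN) auto
qed

lemma continuous_on_1form_orbit:
  assumes "continuous_1form \<alpha>"
  shows "continuous_on S (\<lambda>t. \<alpha> (\<phi> t p) (dflow t p v))"
proof -
  let ?c = "chart_at A p"
  have "continuous_on S (\<lambda>t. (p, t))" by (intro continuous_intros)
  moreover have "p \<in> fst ?c" by simp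
  ultimately show ?thesis
    using continuous_on_compose2[OF continuous_on_1form_dflow[OF assms, of ?c "coord A ?c p v"], of S "Pair p"]
    by (simp add: image_subset_iff)
qed

lemma linear_flow_average:
  assumes "continuous_1form \<alpha>"
  shows "linear (flow_average \<alpha> p)"
proof (rule linearI)
  have int: "(\<lambda>t. \<alpha> (\<phi> t p) (dflow t p v)) integrable_on {0..1}" for v
    using continuous_on_1form_orbit[OF assms] by (rule integrable_continuous_real)
  show "flow_average \<alpha> p (v + w) = flow_average \<alpha> p v + flow_average \<alpha> p w" for v w
    using int
    by (simp add: flow_average_def linear_add[OF linear_dflow] linear_add[OF linear_1form[OF assms]]
        integral_add)
  show "flow_average \<alpha> p (a *\<^sub>R v) = a *\<^sub>R flow_average \<alpha> p v" for a v
    by (simp add: flow_average_def linear_cmul[OF linear_dflow] linear_cmul[OF linear_1form[OF assms]])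
qed

lemma continuous_1form_flow_average:
  assumes "continuous_1form \<alpha>"
  shows "continuous_1form (flow_average \<alpha>)"
  unfolding continuous_1form_def
proof (intro conjI allI ballI)
  show "linear (flow_average \<alpha> p)" for p by (rule linear_flow_average[OF assms])
  fix c v assume c: "c \<in> A"
  have "continuous_on (fst c \<times> cbox 0 1) (\<lambda>(p, t). \<alpha> (\<phi> t p) (dflow t p (uncoord A c p v)))"
    using continuous_on_1form_dflow[OF assms c] by (rule continuous_on_subset) auto
  from integral_continuous_on_param[OF this]
  show "continuous_on (fst c) (\<lambda>p. flow_average \<alpha> p (uncoord A c p v))"
    by (simp add: flow_average_def)
qed

lemma flow_average_differentiable:
  assumes "continuous_1form \<alpha>"
  shows "(\<lambda>t. flow_average \<alpha> (\<phi> t p) (dflow t p v)) differentiable (at 0)"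
proof -
  have "flow_average \<alpha> (\<phi> t p) (dflow t p v)
      = integral {0..1} (\<lambda>s. \<alpha> (\<phi> (s + t) p) (dflow (s + t) p v))" for t
    by (simp add: flow_average_def flow_add dflow_add)
  then show ?thesis
    using sliding_integral_has_derivative[OF continuous_on_1form_orbit[OF assms, of UNIV p v]]
    by (simp add: real_differentiable_def) blast
qed

text \<open>
  By the mean value theorem, the average of \<open>\<alpha>\<close> is nonzero at every vector on whose orbit
  \<open>\<alpha>\<close> has no zero. Averaging thus preserves the kernel of a form when this kernel is invariant
  under the flow.
\<close>

lemma flow_average_eq_value_on_orbit:
  assumes "continuous_1form \<alpha>"
  obtains t where "flow_average \<alpha> p v = \<alpha> (\<phi> t p) (dflow t p v)"
proof -
  obtain s where "integral {0..1} (\<lambda>t. \<alpha> (\<phi> t p) (dflow t p v)) = \<alpha> (\<phi> s p) (dflow s p v)"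
    using integral_mean_value[OF continuous_on_1form_orbit[OF assms]] by blast
  then show ?thesis by (intro that) (simp add: flow_average_def)
qed

end


section \<open>Alternating 3-forms\<close>

definition alternating_3form :: "(vec3 \<Rightarrow> vec3 \<Rightarrow> vec3 \<Rightarrow> real) \<Rightarrow> bool" where
  "alternating_3form F \<longleftrightarrow>
     (\<forall>u v. linear (\<lambda>w. F w u v) \<and> linear (\<lambda>w. F u w v) \<and> linear (\<lambda>w. F u v w)) \<and>
     (\<forall>u v. F u u v = 0 \<and> F u v u = 0 \<and> F v u u = 0)"

lemma alternating_3form_add:
  assumes "alternating_3form F"
  shows "F (x + y) u v = F x u v + F y u v" "F u (x + y) v = F u x v + F u y v"
    "F u v (x + y) = F u v x + F u v y"
  using assms linear_add[of "\<lambda>w. F w u v" x y] linear_add[of "\<lambda>w. F u w v" x y]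
    linear_add[of "\<lambda>w. F u v w" x y]
  by (simp_all add: alternating_3form_def)

lemma alternating_3form_scale:
  assumes "alternating_3form F"
  shows "F (k *\<^sub>R x) u v = k * F x u v" "F u (k *\<^sub>R x) v = k * F u x v"
    "F u v (k *\<^sub>R x) = k * F u v x"
  using assms linear_cmul[of "\<lambda>w. F w u v" k x] linear_cmul[of "\<lambda>w. F u w v" k x]
    linear_cmul[of "\<lambda>w. F u v w" k x]
  by (simp_all add: alternating_3form_def)

lemma alternating_3form_zero:
  assumes "alternating_3form F"
  shows "F u u v = 0" "F u v u = 0" "F v u u = 0"
  using assms by (simp_all add: alternating_3form_def)

lemma alternating_3form_swap:
  assumes "alternating_3form F"
  shows "F v u w = - F u v w" "F u w v = - F u v w"
proof -
  have "F u v w + F v u w = F (u + v) (u + v) w" "F u v w + F u w v = F u (v + w) (v + w)"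
    unfolding alternating_3form_add[OF assms] by (simp_all add: alternating_3form_zero[OF assms])
  then show "F v u w = - F u v w" "F u w v = - F u v w"
    by (simp_all add: alternating_3form_zero[OF assms])
qed

lemma alternating_3form_expand:
  assumes F: "alternating_3form F"
  shows "F (x1 *\<^sub>R a + x2 *\<^sub>R b + x3 *\<^sub>R c) (y1 *\<^sub>R a + y2 *\<^sub>R b + y3 *\<^sub>R c)
           (z1 *\<^sub>R a + z2 *\<^sub>R b + z3 *\<^sub>R c)
         = (x1 * (y2 * z3 - y3 * z2) - x2 * (y1 * z3 - y3 * z1) + x3 * (y1 * z2 - y2 * z1)) * F a b c"
proof -
  have "F b a c = - F a b c" "F a c b = - F a b c" "F b c a = F a b c" "F c a b = F a b c"
      "F c b a = - F a b c"
    using alternating_3form_swap[OF F] by metis+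
  then show ?thesis
    by (simp add: alternating_3form_add[OF F] alternating_3form_scale[OF F] alternating_3form_zero[OF F])
       (simp add: algebra_simps)
qed

text \<open>
  A spanning triple of the three-dimensional space \<open>vec3\<close> is a basis.
\<close>

definition frame :: "vec3 \<Rightarrow> vec3 \<Rightarrow> vec3 \<Rightarrow> bool" where
  "frame a b c \<longleftrightarrow> (\<forall>v. \<exists>x y z. v = x *\<^sub>R a + y *\<^sub>R b + z *\<^sub>R c)"

text \<open>
  The space of alternating 3-forms is one-dimensional. The cross-multiplied form of the
  proportionality keeps \<open>F\<close> and \<open>G\<close> symmetric and leaves the possibility open that they vanish.
\<close>

lemma alternating_3forms_proportional:
  assumes "alternating_3form F" "alternating_3form G" "frame a b c"
  shows "F u v w * G a b c = G u v w * F a b c"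
proof -
  obtain x1 x2 x3 y1 y2 y3 z1 z2 z3 where
    "u = x1 *\<^sub>R a + x2 *\<^sub>R b + x3 *\<^sub>R c" "v = y1 *\<^sub>R a + y2 *\<^sub>R b + y3 *\<^sub>R c"
    "w = z1 *\<^sub>R a + z2 *\<^sub>R b + z3 *\<^sub>R c"
    using assms(3) unfolding frame_def by meson
  then show ?thesis
    by (simp only: alternating_3form_expand[OF assms(1)] alternating_3form_expand[OF assms(2)] mult_ac)
qed

lemma alternating_3form_nonzero_on_frame:
  assumes "alternating_3form F" "frame a b c" "F u v w \<noteq> 0"
  shows "F a b c \<noteq> 0"
proof -
  obtain x1 x2 x3 y1 y2 y3 z1 z2 z3 where
    "u = x1 *\<^sub>R a + x2 *\<^sub>R b + x3 *\<^sub>R c" "v = y1 *\<^sub>R a + y2 *\<^sub>R b + y3 *\<^sub>R c"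
    "w = z1 *\<^sub>R a + z2 *\<^sub>R b + z3 *\<^sub>R c"
    using assms(2) unfolding frame_def by meson
  with assms(3) show ?thesis
    by (auto simp only: alternating_3form_expand[OF assms(1)] mult_eq_0_iff)
qed

lemma volume_form_alternating: "volume_form A \<Omega> \<Longrightarrow> alternating_3form (\<Omega> p)"
  unfolding volume_form_def alternating_3form_def by blast

context smooth_manifold
begin

lemma continuous_on_volume_form_fields:
  assumes \<Omega>: "volume_form A \<Omega>" and c: "c \<in> A"
    and Y: "continuous_field_on A V Y" and Z: "continuous_field_on A V Z"
    and W: "continuous_field_on A V W"
  shows "continuous_on (V \<inter> fst c) (\<lambda>p. \<Omega> p (Y p) (Z p) (W p))"
proof -
  let ?S = "V \<inter> fst c" and ?u = "uncoord A c" and ?k = "coord A c"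
  have coord: "continuous_on ?S (\<lambda>p. ?k p (Y p))" "continuous_on ?S (\<lambda>p. ?k p (Z p))"
      "continuous_on ?S (\<lambda>p. ?k p (W p))"
    using Y Z W c by (simp_all add: continuous_field_on_def)
  have lin: "linear (\<lambda>w. \<Omega> p (?u p w) u v)" "linear (\<lambda>w. \<Omega> p u (?u p w) v)"
      "linear (\<lambda>w. \<Omega> p u v (?u p w))" if "p \<in> ?S" for p u v
  proof -
    have l: "linear (?u p)" using that by (intro linear_uncoord c) simp
    show "linear (\<lambda>w. \<Omega> p (?u p w) u v)" "linear (\<lambda>w. \<Omega> p u (?u p w) v)"
      "linear (\<lambda>w. \<Omega> p u v (?u p w))"
      using \<Omega> linear_compose[OF l, of "\<lambda>w. \<Omega> p w u v"] linear_compose[OF l, of "\<lambda>w. \<Omega> p u w v"]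
        linear_compose[OF l, of "\<lambda>w. \<Omega> p u v w"]
      by (simp_all add: volume_form_def o_def)
  qed
  have "continuous_on ?S (\<lambda>p. \<Omega> p (?u p u) (?u p v) (?u p w))" for u v w
    using \<Omega> c unfolding volume_form_def by (meson continuous_on_subset inf_le2)
  then have "continuous_on ?S (\<lambda>p. \<Omega> p (?u p (?k p (Y p))) (?u p v) (?u p w))" for v w
    by (intro continuous_on_linear_apply[of ?S "\<lambda>p x. \<Omega> p (?u p x) (?u p v) (?u p w)" "\<lambda>p. ?k p (Y p)"]
        lin coord)
  then have "continuous_on ?S (\<lambda>p. \<Omega> p (?u p (?k p (Y p))) (?u p (?k p (Z p))) (?u p w))" for w
    by (intro continuous_on_linear_apply[of ?S "\<lambda>p x. \<Omega> p (?u p (?k p (Y p))) (?u p x) (?u p w)"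
          "\<lambda>p. ?k p (Z p)"] lin coord)
  then have "continuous_on ?S
      (\<lambda>p. \<Omega> p (?u p (?k p (Y p))) (?u p (?k p (Z p))) (?u p (?k p (W p))))"
    by (intro continuous_on_linear_apply[of ?S "\<lambda>p x. \<Omega> p (?u p (?k p (Y p))) (?u p (?k p (Z p))) (?u p x)"
          "\<lambda>p. ?k p (W p)"] lin coord)
  then show ?thesis
    by (rule continuous_on_eq) (simp add: c)
qed

end

section \<open>Lines in the quotient bundle as planes containing the flow direction\<close>

definition plane :: "('a \<Rightarrow> vec3 set set) \<Rightarrow> 'a \<Rightarrow> vec3 set" where
  "plane E p = \<Union>(E p)"

text \<open>
  Such a vector represents a nonzero element of the line \<open>E p\<close>; together with \<open>X p\<close> it spans
  the plane.
\<close>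

definition nonflow_vectors :: "('a \<Rightarrow> vec3) \<Rightarrow> ('a \<Rightarrow> vec3 set set) \<Rightarrow> 'a \<Rightarrow> vec3 set" where
  "nonflow_vectors X E p = plane E p - span {X p}"

lemma mem_qproj_iff: "w \<in> qproj X p v \<longleftrightarrow> (\<exists>a. w = v + a *\<^sub>R X p)"
  by (auto simp: qproj_def)

lemma qproj_add_generator: "qproj X p (v + a *\<^sub>R X p) = qproj X p v"
proof (intro set_eqI iffI)
  fix w
  show "w \<in> qproj X p v" if "w \<in> qproj X p (v + a *\<^sub>R X p)"
    using that unfolding mem_qproj_iff by (metis add.assoc scaleR_left_distrib)
  show "w \<in> qproj X p (v + a *\<^sub>R X p)" if "w \<in> qproj X p v"
  proof -
    from that obtain b where "w = v + b *\<^sub>R X p" unfolding mem_qproj_iff by blast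
    then have "w = (v + a *\<^sub>R X p) + (b - a) *\<^sub>R X p" by (simp add: algebra_simps)
    then show ?thesis unfolding mem_qproj_iff by blast
  qed
qed

lemma mem_span_generator_iff: "v \<in> span {X p} \<longleftrightarrow> (\<exists>a. v = a *\<^sub>R (X p :: vec3))"
  by (auto simp: span_singleton)

lemma qproj_eq_zero_iff: "qproj X p v = qproj X p 0 \<longleftrightarrow> v \<in> span {X p}"
proof
  assume "qproj X p v = qproj X p 0"
  moreover have "v \<in> qproj X p v" unfolding mem_qproj_iff by (metis add.right_neutral scale_zero_left)
  ultimately show "v \<in> span {X p}" by (auto simp: mem_qproj_iff mem_span_generator_iff)
next
  assume "v \<in> span {X p}"
  then show "qproj X p v = qproj X p 0"
    using qproj_add_generator[of X p 0] by (auto simp: mem_span_generator_iff)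
qed

lemma mem_plane_qline_iff:
  assumes "E p = qline X p e"
  shows "v \<in> plane E p \<longleftrightarrow> (\<exists>a b. v = a *\<^sub>R e + b *\<^sub>R X p)"
  using assms by (auto simp: plane_def qline_def mem_qproj_iff)

lemma line_subbundle_fibre:
  assumes "continuous_line_subbundle A X E"
  obtains e where "e \<notin> span {X p}" "E p = qline X p e"
  using assms unfolding continuous_line_subbundle_def qproj_eq_zero_iff by metis

lemma line_subbundle_facts:
  assumes E: "continuous_line_subbundle A X E"
  shows generator_in_plane: "X p \<in> plane E p"
    and plane_span: "e \<in> nonflow_vectors X E p \<Longrightarrow> v \<in> plane E p \<Longrightarrow> \<exists>a b. v = a *\<^sub>R e + b *\<^sub>R X p"
    and coset_in_line_iff: "qproj X p v \<in> E p \<longleftrightarrow> v \<in> plane E p"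
    and line_subbundle_coset: "q \<in> E p \<Longrightarrow> \<exists>v. v \<in> plane E p \<and> q = qproj X p v"
    and nonflow_vectors_nonempty: "nonflow_vectors X E p \<noteq> {}"
    and plane_subspace: "subspace (plane E p)"
proof -
  obtain e0 where e0: "e0 \<notin> span {X p}" "E p = qline X p e0"
    using line_subbundle_fibre[OF E] by metis
  note iff = mem_plane_qline_iff[where E = E and p = p, OF e0(2)]
  show "X p \<in> plane E p"
    unfolding iff by (rule exI[of _ 0], rule exI[of _ 1]) simp
  show "\<exists>a b. v = a *\<^sub>R e + b *\<^sub>R X p" if et: "e \<in> nonflow_vectors X E p" and vp: "v \<in> plane E p"
  proof -
    obtain a b a' b' where v: "v = a *\<^sub>R e0 + b *\<^sub>R X p" and e: "e = a' *\<^sub>R e0 + b' *\<^sub>R X p"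
      using et vp iff unfolding nonflow_vectors_def by blast
    have "a' \<noteq> 0"
      using et e by (auto simp: nonflow_vectors_def mem_span_generator_iff)
    then have "v = (a / a') *\<^sub>R e + (b - a / a' * b') *\<^sub>R X p"
      by (simp add: v e algebra_simps)
    then show ?thesis by blast
  qed
  show "qproj X p v \<in> E p \<longleftrightarrow> v \<in> plane E p"
  proof
    assume "qproj X p v \<in> E p"
    moreover have "v \<in> qproj X p v" unfolding mem_qproj_iff by (metis add.right_neutral scale_zero_left)
    ultimately show "v \<in> plane E p" unfolding plane_def by blast
  next
    assume "v \<in> plane E p"
    then obtain a b where "v = a *\<^sub>R e0 + b *\<^sub>R X p" using iff by blast
    then have "qproj X p v = qproj X p (a *\<^sub>R e0)" by (simp add: qproj_add_generator)
    then show "qproj X p v \<in> E p" by (simp add: e0(2) qline_def)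
  qed
  show "\<exists>v. v \<in> plane E p \<and> q = qproj X p v" if q: "q \<in> E p"
  proof -
    obtain a where a: "q = qproj X p (a *\<^sub>R e0)" using q by (auto simp: e0(2) qline_def)
    have "a *\<^sub>R e0 \<in> plane E p" unfolding iff by (metis add.right_neutral scale_zero_left)
    with a show ?thesis by blast
  qed
  have "e0 \<in> plane E p" unfolding iff by (rule exI[of _ 1], rule exI[of _ 0]) simp
  with e0(1) show "nonflow_vectors X E p \<noteq> {}" by (auto simp: nonflow_vectors_def)
  show "subspace (plane E p)"
  proof -
    have "plane E p = span {e0, X p}"
      using iff by (auto simp: span_insert span_singleton algebra_simps)
    then show ?thesis by (simp only: subspace_span)
  qed
qed

context smooth_manifold
begin

text \<open>
  The plane of a line \<open>E\<close> in the quotient is the kernel of the 1-form \<open>\<Omega>(X, e, \<cdot>)\<close> for \<open>e\<close> in this plane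
  but not along the flow. This form depends on \<open>e\<close>, which in general is available only locally:
  replacing \<open>e\<close> by \<open>a e + b X\<close> multiplies it by \<open>a\<close>. The same factor appears in \<open>\<gamma>(e)\<close>, so
  the quotient does not depend on \<open>e\<close>, is globally defined, and inherits continuity from the local
  sections of \<open>E\<close>.
\<close>

lemma exists_continuous_contraction:
  assumes \<Omega>: "volume_form A \<Omega>" and X: "continuous_field_on A UNIV X"
    and E: "continuous_line_subbundle A X E" and \<gamma>: "continuous_1form \<gamma>"
    and \<gamma>_X: "\<And>p. \<gamma> p (X p) = 0"
    and \<gamma>_E: "\<And>p e. e \<in> nonflow_vectors X E p \<Longrightarrow> \<gamma> p e \<noteq> 0"
  obtains \<beta> where "continuous_1form \<beta>"
    "\<And>p e v. e \<in> nonflow_vectors X E p \<Longrightarrow> \<beta> p v = \<Omega> p (X p) e v / \<gamma> p e"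
proof -
  define \<epsilon> where "\<epsilon> p = (SOME e. e \<in> nonflow_vectors X E p)" for p
  have \<epsilon>: "\<epsilon> p \<in> nonflow_vectors X E p" for p
    unfolding \<epsilon>_def using nonflow_vectors_nonempty[OF E] by (simp add: some_in_eq)
  define \<beta> where "\<beta> p v = \<Omega> p (X p) (\<epsilon> p) v / \<gamma> p (\<epsilon> p)" for p v
  note \<Omega>p = volume_form_alternating[OF \<Omega>]
  have \<beta>: "\<beta> p v = \<Omega> p (X p) e v / \<gamma> p e" if e: "e \<in> nonflow_vectors X E p" for p e v
  proof -
    obtain a b where eq: "e = a *\<^sub>R \<epsilon> p + b *\<^sub>R X p"
      using plane_span[OF E \<epsilon>, of e p] e by (auto simp: nonflow_vectors_def)
    have "a \<noteq> 0"
      using e by (auto simp: eq nonflow_vectors_def mem_span_generator_iff)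
    moreover have "\<gamma> p e = a * \<gamma> p (\<epsilon> p)"
      by (simp add: eq linear_add[OF linear_1form[OF \<gamma>]] linear_cmul[OF linear_1form[OF \<gamma>]] \<gamma>_X)
    moreover have "\<Omega> p (X p) e v = a * \<Omega> p (X p) (\<epsilon> p) v"
      by (simp add: eq alternating_3form_add[OF \<Omega>p] alternating_3form_scale[OF \<Omega>p]
          alternating_3form_zero[OF \<Omega>p])
    ultimately show ?thesis by (simp add: \<beta>_def)
  qed
  have "continuous_1form \<beta>"
    unfolding continuous_1form_def
  proof (intro conjI allI ballI)
    show "linear (\<beta> p)" for p
      by (intro linearI) (simp_all add: \<beta>_def alternating_3form_add[OF \<Omega>p]
          alternating_3form_scale[OF \<Omega>p] add_divide_distrib)
    fix c v assume c: "c \<in> A"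
    have "\<forall>p. \<exists>V e. open V \<and> p \<in> V \<and> continuous_field_on A V e \<and>
        (\<forall>q\<in>V. e q \<in> nonflow_vectors X E q)"
    proof
      fix p
      obtain V e where V: "open V" "p \<in> V" "continuous_field_on A V e"
          "\<And>q. q \<in> V \<Longrightarrow> qproj X q (e q) \<noteq> qproj X q 0 \<and> E q = qline X q (e q)"
        using E[unfolded continuous_line_subbundle_def, THEN spec, of p] by blast
      have "e q \<in> nonflow_vectors X E q" if "q \<in> V" for q
      proof -
        have "E q = qline X q (e q)" using V(4)[OF that] by blast
        from mem_plane_qline_iff[where E = E and p = q, OF this] have "e q \<in> plane E q"
          by (metis add.right_neutral scale_one scale_zero_left)
        then show ?thesis
          using V(4)[OF that] by (simp add: nonflow_vectors_def qproj_eq_zero_iff)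
      qed
      with V show "\<exists>V e. open V \<and> p \<in> V \<and> continuous_field_on A V e \<and>
        (\<forall>q\<in>V. e q \<in> nonflow_vectors X E q)" by blast
    qed
    then obtain V e where V: "\<And>p. open (V p)" "\<And>p. p \<in> V p"
        "\<And>p. continuous_field_on A (V p) (e p)"
        "\<And>p q. q \<in> V p \<Longrightarrow> e p q \<in> nonflow_vectors X E q"
      by metis
    have "continuous_on (V p \<inter> fst c) (\<lambda>q. \<beta> q (uncoord A c q v))" for p
    proof -
      have "continuous_on (V p \<inter> fst c \<inter> fst c) (\<lambda>q. \<Omega> q (X q) (e p q) (uncoord A c q v))"
        using continuous_field_on_subset[OF X, of "V p \<inter> fst c"]
          continuous_field_on_subset[OF V(3), of "V p \<inter> fst c"]
          continuous_field_on_subset[OF continuous_field_on_uncoord[OF c], of "V p \<inter> fst c"]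
        by (intro continuous_on_volume_form_fields[OF \<Omega> c]) auto
      moreover have "continuous_on (V p \<inter> fst c) (\<lambda>q. \<gamma> q (e p q))"
        using continuous_on_1form_field[OF \<gamma> V(1) V(3)] by (rule continuous_on_subset) simp
      ultimately have "continuous_on (V p \<inter> fst c)
          (\<lambda>q. \<Omega> q (X q) (e p q) (uncoord A c q v) / \<gamma> q (e p q))"
        using V(4) \<gamma>_E by (intro continuous_on_divide) (simp_all add: Int_assoc)
      then show ?thesis
        by (rule continuous_on_eq) (simp add: \<beta>[OF V(4)[of _ p]])
    qed
    then have "continuous_on (\<Union>p. V p \<inter> fst c) (\<lambda>q. \<beta> q (uncoord A c q v))"
      using V(1) open_chart_domain[OF c] by (intro continuous_on_open_UN) auto
    moreover have "(\<Union>p. V p \<inter> fst c) = fst c" using V(2) by blast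
    ultimately show "continuous_on (fst c) (\<lambda>q. \<beta> q (uncoord A c q v))" by simp
  qed
  with \<beta> show ?thesis using that by blast
qed

end


section \<open>The frame of an invariant splitting\<close>

locale invariant_splitting = flow_on_manifold A X \<phi>
  for A :: "'a::t2_space chart set" and X :: "'a \<Rightarrow> vec3" and \<phi> :: "real \<Rightarrow> 'a \<Rightarrow> 'a" +
  fixes Es Eu :: "'a \<Rightarrow> vec3 set set"
  assumes generator_nonzero: "X p \<noteq> 0"
    and splitting: "projectively_Anosov_splitting A X \<phi> Es Eu"
begin

lemma line_s: "continuous_line_subbundle A X Es"
  and line_u: "continuous_line_subbundle A X Eu"
  using splitting by (simp_all add: projectively_Anosov_splitting_def)

lemma invariant_s: "qflow A \<phi> t p ` Es p = Es (\<phi> t p)"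
  and invariant_u: "qflow A \<phi> t p ` Eu p = Eu (\<phi> t p)"
  and lines_span: "\<exists>u w. qproj X p u \<in> Es p \<and> qproj X p w \<in> Eu p \<and> v = u + w"
  using splitting by (simp_all add: projectively_Anosov_splitting_def)

lemma frame_adapted:
  assumes e: "e \<in> nonflow_vectors X Es p" and f: "f \<in> nonflow_vectors X Eu p"
  shows "frame (X p) e f"
  unfolding frame_def
proof
  fix v
  obtain u w where uw: "qproj X p u \<in> Es p" "qproj X p w \<in> Eu p" "v = u + w"
    using lines_span by blast
  obtain a b where u: "u = a *\<^sub>R e + b *\<^sub>R X p"
    using uw(1) plane_span[OF line_s e] by (metis coset_in_line_iff[OF line_s])
  obtain a' b' where w: "w = a' *\<^sub>R f + b' *\<^sub>R X p"
    using uw(2) plane_span[OF line_u f] by (metis coset_in_line_iff[OF line_u])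
  have "v = (b + b') *\<^sub>R X p + a *\<^sub>R e + a' *\<^sub>R f"
    by (simp add: uw(3) u w algebra_simps)
  then show "\<exists>x y z. v = x *\<^sub>R X p + y *\<^sub>R e + z *\<^sub>R f" by blast
qed

end

section \<open>Invariant planes, divergence and expansion rates\<close>

context flow_on_manifold
begin

text \<open>
  Invariance gives one direction for every time; applied to \<open>- t\<close> it gives the converse.
\<close>

lemma dflow_plane:
  assumes E: "continuous_line_subbundle A X E"
    and inv: "\<And>t p. qflow A \<phi> t p ` E p = E (\<phi> t p)"
  shows "dflow t p v \<in> plane E (\<phi> t p) \<longleftrightarrow> v \<in> plane E p"
proof -
  have *: "dflow t p v \<in> plane E (\<phi> t p)" if v: "v \<in> plane E p" for t p v
  proof -
    obtain q where "q \<in> E p" "v \<in> q" using v unfolding plane_def by blast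
    then have "dflow t p v \<in> qflow A \<phi> t p q" "qflow A \<phi> t p q \<in> E (\<phi> t p)"
      using inv[of t p] by (auto simp: qflow_def)
    then show ?thesis unfolding plane_def by blast
  qed
  moreover have "dflow (- t) (\<phi> t p) (dflow t p v) = v"
    using dflow_add[of "- t" t p v] by simp
  ultimately show ?thesis by (metis flow_minus)
qed

lemma dflow_span_generator: "dflow t p v \<in> span {X (\<phi> t p)} \<longleftrightarrow> v \<in> span {X p}"
proof -
  have *: "dflow t p v \<in> span {X (\<phi> t p)}" if "v \<in> span {X p}" for t p v
    using that by (auto simp: mem_span_generator_iff linear_cmul[OF linear_dflow] dflow_generator)
  moreover have "dflow (- t) (\<phi> t p) (dflow t p v) = v"
    using dflow_add[of "- t" t p v] by simp
  ultimately show ?thesis by (metis flow_minus)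
qed

lemma dflow_nonflow_vectors:
  assumes "continuous_line_subbundle A X E" "\<And>t p. qflow A \<phi> t p ` E p = E (\<phi> t p)"
  shows "dflow t p v \<in> nonflow_vectors X E (\<phi> t p) \<longleftrightarrow> v \<in> nonflow_vectors X E p"
  by (simp add: nonflow_vectors_def dflow_plane[OF assms] dflow_span_generator)

lemma qflow_qproj: "qflow A \<phi> t p (qproj X p v) = qproj X (\<phi> t p) (dflow t p v)"
proof -
  have "dflow t p (v + a *\<^sub>R X p) = dflow t p v + a *\<^sub>R X (\<phi> t p)" for a
    by (simp add: linear_add[OF linear_dflow] linear_cmul[OF linear_dflow] dflow_generator)
  then show ?thesis
    unfolding qflow_def qproj_def by (simp add: full_SetCompr_eq image_image)
qed

lemma alternating_pullback:
  assumes "volume_form A \<Omega>"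
  shows "alternating_3form (pullback_form A (\<phi> t) \<Omega> p)"
proof -
  have "linear (\<lambda>w. \<Omega> (\<phi> t p) (dflow t p w) u v)" "linear (\<lambda>w. \<Omega> (\<phi> t p) u (dflow t p w) v)"
    "linear (\<lambda>w. \<Omega> (\<phi> t p) u v (dflow t p w))" for u v
    using assms
      linear_compose[OF linear_dflow, of "\<lambda>w. \<Omega> (\<phi> t p) w u v" t p]
      linear_compose[OF linear_dflow, of "\<lambda>w. \<Omega> (\<phi> t p) u w v" t p]
      linear_compose[OF linear_dflow, of "\<lambda>w. \<Omega> (\<phi> t p) u v w" t p]
    by (simp_all add: volume_form_def o_def)
  then show ?thesis
    by (simp add: alternating_3form_def pullback_form_def
        alternating_3form_zero[OF volume_form_alternating[OF assms]])
qed

text \<open>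
  All pullbacks of \<open>\<Omega>\<close> are multiples of \<open>\<Omega>\<close> at \<open>p\<close>, so the growth of \<open>\<Omega>\<close> on one frame carried along
  by the flow already determines the divergence.
\<close>

lemma divergence_eq:
  assumes \<Omega>: "volume_form A \<Omega>" and abc: "frame a b c"
    and D: "((\<lambda>t. pullback_form A (\<phi> t) \<Omega> p a b c) has_real_derivative D) (at 0)"
  shows "divergence A \<phi> \<Omega> p = D / \<Omega> p a b c"
proof -
  note \<Omega>p = volume_form_alternating[OF \<Omega>, of p]
  obtain u v w where "\<Omega> p u v w \<noteq> 0" using \<Omega> unfolding volume_form_def by blast
  from alternating_3form_nonzero_on_frame[OF \<Omega>p abc this] have nz: "\<Omega> p a b c \<noteq> 0" .
  have L: "Lie_derivative_form A \<phi> \<Omega> p u v w = D / \<Omega> p a b c * \<Omega> p u v w" for u v w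
  proof -
    have "pullback_form A (\<phi> t) \<Omega> p u v w
        = \<Omega> p u v w / \<Omega> p a b c * pullback_form A (\<phi> t) \<Omega> p a b c" for t
      using alternating_3forms_proportional[OF alternating_pullback[OF \<Omega>] \<Omega>p abc, of t p u v w] nz
      by (simp add: field_simps)
    moreover have "((\<lambda>t. \<Omega> p u v w / \<Omega> p a b c * pullback_form A (\<phi> t) \<Omega> p a b c)
        has_real_derivative \<Omega> p u v w / \<Omega> p a b c * D) (at 0)"
      by (intro DERIV_cmult D)
    ultimately have "((\<lambda>t. pullback_form A (\<phi> t) \<Omega> p u v w)
        has_real_derivative \<Omega> p u v w / \<Omega> p a b c * D) (at 0)"
      by presburger
    then show ?thesis
      by (simp add: Lie_derivative_form_def DERIV_imp_deriv)
  qed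
  show ?thesis
    unfolding divergence_def
  proof (rule the_equality)
    show "\<forall>u v w. Lie_derivative_form A \<phi> \<Omega> p u v w = D / \<Omega> p a b c * \<Omega> p u v w"
      using L by blast
    show "d = D / \<Omega> p a b c"
      if "\<forall>u v w. Lie_derivative_form A \<phi> \<Omega> p u v w = d * \<Omega> p u v w" for d
      using that L[of a b c] nz by (metis mult_right_cancel)
  qed
qed

text \<open>
  When the induced norm on a line is the absolute value of a 1-form \<open>\<sigma>\<close> that vanishes on \<open>X\<close>,
  rescaling a vector of the line changes \<open>\<sigma>\<close> along its orbit by a constant factor only. Hence the
  logarithmic derivative of \<open>\<sigma>\<close> at any nonzero vector of the line is the rate.
\<close>

lemma expansion_rate_eq:
  assumes E: "continuous_line_subbundle A X E"
    and inv: "\<And>t p. qflow A \<phi> t p ` E p = E (\<phi> t p)"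
    and \<sigma>: "\<And>p. linear (\<sigma> p)" "\<And>p. \<sigma> p (X p) = 0"
    and norm: "\<And>p v. v \<in> plane E p \<Longrightarrow> induced_norm X g p (qproj X p v) = \<bar>\<sigma> p v\<bar>"
    and e: "e \<in> nonflow_vectors X E p" "\<sigma> p e \<noteq> 0"
    and D: "((\<lambda>t. \<sigma> (\<phi> t p) (dflow t p e)) has_real_derivative D) (at 0)"
  shows "expansion_rate A X \<phi> g E p = D / \<sigma> p e"
proof -
  have ep: "e \<in> plane E p" using e(1) by (simp add: nonflow_vectors_def)
  have rate: "((\<lambda>t. ln (induced_norm X g (\<phi> t p) (qflow A \<phi> t p q))) has_real_derivative D / \<sigma> p e) (at 0)"
    if q: "q \<in> E p" "induced_norm X g p q = 1" for q
  proof -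
    obtain v where v: "v \<in> plane E p" "q = qproj X p v"
      using line_subbundle_coset[OF E q(1)] by blast
    obtain a b where ab: "v = a *\<^sub>R e + b *\<^sub>R X p"
      using plane_span[OF E e(1) v(1)] by blast
    have \<sigma>v: "\<sigma> (\<phi> t p) (dflow t p v) = a * \<sigma> (\<phi> t p) (dflow t p e)" for t
      by (simp add: ab linear_add[OF linear_dflow] linear_cmul[OF linear_dflow] dflow_generator
          linear_add[OF \<sigma>(1)] linear_cmul[OF \<sigma>(1)] \<sigma>(2))
    have "\<bar>\<sigma> p v\<bar> = 1" using q(2) norm[OF v(1)] v(2) by simp
    then have a: "a \<noteq> 0" using \<sigma>v[of 0] by auto
    \<comment> \<open>Writing the logarithm through the square avoids the sign of \<open>\<sigma>\<close>.\<close>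
    have "ln (induced_norm X g (\<phi> t p) (qflow A \<phi> t p q))
        = ln ((a * \<sigma> (\<phi> t p) (dflow t p e))\<^sup>2) / 2" for t
    proof -
      have "induced_norm X g (\<phi> t p) (qflow A \<phi> t p q) = \<bar>a * \<sigma> (\<phi> t p) (dflow t p e)\<bar>"
        using v(1) by (simp add: v(2) qflow_qproj norm dflow_plane[OF E inv] \<sigma>v)
      moreover have "ln \<bar>x\<bar> = ln (x\<^sup>2) / 2" for x :: real
        using ln_realpow[of "\<bar>x\<bar>" 2] by (cases "x = 0") simp_all
      ultimately show ?thesis by simp
    qed
    moreover have "((\<lambda>t. ln ((a * \<sigma> (\<phi> t p) (dflow t p e))\<^sup>2) / 2) has_real_derivative D / \<sigma> p e) (at 0)"
    proof -
      have "(a * \<sigma> (\<phi> 0 p) (dflow 0 p e))\<^sup>2 > 0" using a e(2) by simp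
      moreover have "((\<lambda>t. (a * \<sigma> (\<phi> t p) (dflow t p e))\<^sup>2) has_real_derivative
          2 * (a * \<sigma> p e) * (a * D)) (at 0)"
        by (auto intro!: derivative_eq_intros D)
      ultimately have "((\<lambda>t. ln ((a * \<sigma> (\<phi> t p) (dflow t p e))\<^sup>2)) has_real_derivative
          1 / (a * \<sigma> p e)\<^sup>2 * (2 * (a * \<sigma> p e) * (a * D))) (at 0)"
        using DERIV_chain2[OF DERIV_ln_divide, of "\<lambda>t. (a * \<sigma> (\<phi> t p) (dflow t p e))\<^sup>2" 0] by simp
      from DERIV_cdivide[OF this, of 2] show ?thesis
        using a e(2) by (simp add: power2_eq_square)
    qed
    ultimately show ?thesis by presburger
  qed
  obtain q where q: "q \<in> E p" "induced_norm X g p q = 1"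
  proof
    have unit: "(1 / \<sigma> p e) *\<^sub>R e \<in> plane E p"
      using plane_subspace[OF E] ep by (simp add: subspace_scale)
    then show "qproj X p ((1 / \<sigma> p e) *\<^sub>R e) \<in> E p"
      by (simp add: coset_in_line_iff[OF E])
    show "induced_norm X g p (qproj X p ((1 / \<sigma> p e) *\<^sub>R e)) = 1"
      using e(2) by (simp add: norm[OF unit] linear_cmul[OF \<sigma>(1)])
  qed
  show ?thesis
    unfolding expansion_rate_def
  proof (rule the_equality)
    show "\<forall>q\<in>E p. induced_norm X g p q = 1 \<longrightarrow>
        ((\<lambda>t. ln (induced_norm X g (\<phi> t p) (qflow A \<phi> t p q))) has_real_derivative D / \<sigma> p e) (at 0)"
      using rate by blast
    show "r = D / \<sigma> p e" if "\<forall>q\<in>E p. induced_norm X g p q = 1 \<longrightarrow>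
        ((\<lambda>t. ln (induced_norm X g (\<phi> t p) (qflow A \<phi> t p q))) has_real_derivative r) (at 0)" for r
      using that q rate[OF q] DERIV_unique by blast
  qed
qed

end

section \<open>The adapted coframe and the metric\<close>

context invariant_splitting
begin

text \<open>
  The coframe has three legs. The form \<open>\<alpha>\<close> singles out the complement \<open>ker \<alpha>\<close> of \<open>X\<close>; it is
  obtained by averaging a form with value 1 on \<open>X\<close>, which keeps this value because the flow
  preserves \<open>X\<close>. The form \<open>\<sigma>\<close> measures the stable direction. It begins as the form with kernel the
  unstable plane and value 1 on a field \<open>n\<close> transverse to that plane; its average has
  the same kernel, as this plane is invariant. The form \<open>\<tau>\<close> measuring the unstable direction is not
  averaged: it is forced by the requirement \<open>\<sigma>(e) \<tau>(f) = \<Omega>(X, e, f)\<close>, and it is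
  differentiable along the flow because \<open>\<Omega>\<close> and \<open>\<sigma>\<close> are.
\<close>

lemma exists_adapted_coframe:
  assumes M: "compact (UNIV :: 'a set)" and n: "transversely_orientable A Eu"
    and \<Omega>: "volume_form A \<Omega>" and \<Omega>_diff: "X_differentiable_form A \<phi> \<Omega>"
  obtains \<alpha> \<sigma> \<tau> where
    "continuous_1form \<alpha>" "continuous_1form \<sigma>" "continuous_1form \<tau>"
    "\<And>p v. (\<lambda>t. \<alpha> (\<phi> t p) (dflow t p v)) differentiable (at 0)"
    "\<And>p v. (\<lambda>t. \<sigma> (\<phi> t p) (dflow t p v)) differentiable (at 0)"
    "\<And>p v. (\<lambda>t. \<tau> (\<phi> t p) (dflow t p v)) differentiable (at 0)"
    "\<And>p. \<alpha> p (X p) = 1"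
    "\<And>p v. v \<in> plane Eu p \<Longrightarrow> \<sigma> p v = 0" "\<And>p v. v \<in> plane Es p \<Longrightarrow> \<tau> p v = 0"
    "\<And>p e f. e \<in> nonflow_vectors X Es p \<Longrightarrow> f \<in> nonflow_vectors X Eu p \<Longrightarrow>
        \<sigma> p e * \<tau> p f = \<Omega> p (X p) e f \<and> \<Omega> p (X p) e f \<noteq> 0"
proof -
  note \<Omega>p = volume_form_alternating[OF \<Omega>]
  have \<Omega>_frame: "\<Omega> p (X p) e f \<noteq> 0"
    if "e \<in> nonflow_vectors X Es p" "f \<in> nonflow_vectors X Eu p" for p e f
    using \<Omega> alternating_3form_nonzero_on_frame[OF \<Omega>p frame_adapted[OF that]]
    unfolding volume_form_def by blast
  obtain \<alpha>0 where \<alpha>0: "continuous_1form \<alpha>0" "\<And>p. \<alpha>0 p (X p) = 1"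
    using exists_1form_normalized_on_field[OF M continuous_generator generator_nonzero] by blast
  define \<alpha> where "\<alpha> = flow_average \<alpha>0"
  have \<alpha>_X: "\<alpha> p (X p) = 1" for p
    by (simp add: \<alpha>_def flow_average_def dflow_generator \<alpha>0)
  obtain n where n: "continuous_field_on A UNIV n" "\<And>p. n p \<notin> plane Eu p"
    using n by (auto simp: transversely_orientable_def plane_def)
  define \<gamma> where "\<gamma> p v = \<Omega> p (X p) v (n p)" for p v
  have "continuous_1form \<gamma>"
    unfolding continuous_1form_def
  proof (intro conjI allI ballI)
    show "linear (\<gamma> p)" for p
      by (intro linearI) (simp_all add: \<gamma>_def alternating_3form_add[OF \<Omega>p] alternating_3form_scale[OF \<Omega>p])
    fix c v assume c: "c \<in> A"
    have "continuous_on (fst c \<inter> fst c) (\<lambda>p. \<Omega> p (X p) (uncoord A c p v) (n p))"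
      using continuous_generator n(1) c
      by (intro continuous_on_volume_form_fields[OF \<Omega> c] continuous_field_on_uncoord)
         (auto intro: continuous_field_on_subset)
    then show "continuous_on (fst c) (\<lambda>p. \<gamma> p (uncoord A c p v))"
      by (simp add: \<gamma>_def)
  qed
  moreover have "\<gamma> p (X p) = 0" for p
    by (simp add: \<gamma>_def alternating_3form_zero[OF \<Omega>p])
  moreover have "\<gamma> p f \<noteq> 0" if f: "f \<in> nonflow_vectors X Eu p" for p f
  proof -
    obtain e where e: "e \<in> nonflow_vectors X Es p"
      using nonflow_vectors_nonempty[OF line_s] by blast
    obtain x y z where xyz: "n p = x *\<^sub>R X p + y *\<^sub>R e + z *\<^sub>R f"
      using frame_adapted[OF e f] unfolding frame_def by blast
    \<comment> \<open>Transversality of \<open>n\<close> to the unstable plane means a nonzero stable component.\<close>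
    have "y \<noteq> 0"
    proof
      assume "y = 0"
      then have "n p = x *\<^sub>R X p + z *\<^sub>R f" by (simp add: xyz)
      moreover have "f \<in> plane Eu p" using f by (simp add: nonflow_vectors_def)
      ultimately have "n p \<in> plane Eu p"
        using plane_subspace[OF line_u] generator_in_plane[OF line_u]
        by (simp add: subspace_add subspace_scale)
      with n(2) show False by blast
    qed
    moreover have "\<gamma> p f = - y * \<Omega> p (X p) e f"
      by (simp add: \<gamma>_def xyz alternating_3form_add[OF \<Omega>p] alternating_3form_scale[OF \<Omega>p]
          alternating_3form_zero[OF \<Omega>p] alternating_3form_swap(2)[OF \<Omega>p, of p "X p" f e])
    ultimately show ?thesis using \<Omega>_frame[OF e f] by simp
  qed
  ultimately obtain \<sigma>0 where \<sigma>0: "continuous_1form \<sigma>0"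
      "\<And>p f v. f \<in> nonflow_vectors X Eu p \<Longrightarrow> \<sigma>0 p v = \<Omega> p (X p) f v / \<gamma> p f"
      and \<gamma>_nz: "\<And>p f. f \<in> nonflow_vectors X Eu p \<Longrightarrow> \<gamma> p f \<noteq> 0"
    using exists_continuous_contraction[OF \<Omega> continuous_generator line_u] by blast
  have \<sigma>0_u: "\<sigma>0 p v = 0" if v: "v \<in> plane Eu p" for p v
  proof -
    obtain f where f: "f \<in> nonflow_vectors X Eu p"
      using nonflow_vectors_nonempty[OF line_u] by blast
    obtain a b where "v = a *\<^sub>R f + b *\<^sub>R X p" using plane_span[OF line_u f v] by blast
    then show ?thesis
      by (simp add: \<sigma>0(2)[OF f] alternating_3form_add[OF \<Omega>p] alternating_3form_scale[OF \<Omega>p]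
          alternating_3form_zero[OF \<Omega>p])
  qed
  have \<sigma>0_s: "\<sigma>0 p e \<noteq> 0" if e: "e \<in> nonflow_vectors X Es p" for p e
  proof -
    obtain f where f: "f \<in> nonflow_vectors X Eu p"
      using nonflow_vectors_nonempty[OF line_u] by blast
    show ?thesis
      using \<Omega>_frame[OF e f] \<gamma>_nz[OF f]
      by (simp add: \<sigma>0(2)[OF f] alternating_3form_swap(2)[OF \<Omega>p, of p "X p" f e])
  qed
  define \<sigma> where "\<sigma> = flow_average \<sigma>0"
  have \<sigma>: "continuous_1form \<sigma>" unfolding \<sigma>_def by (rule continuous_1form_flow_average[OF \<sigma>0(1)])
  have \<sigma>_diff: "(\<lambda>t. \<sigma> (\<phi> t p) (dflow t p v)) differentiable (at 0)" for p v
    unfolding \<sigma>_def by (rule flow_average_differentiable[OF \<sigma>0(1)])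
  have \<sigma>_u: "\<sigma> p v = 0" if "v \<in> plane Eu p" for p v
    using that by (simp add: \<sigma>_def flow_average_def \<sigma>0_u dflow_plane[OF line_u invariant_u])
  have \<sigma>_s: "\<sigma> p e \<noteq> 0" if e: "e \<in> nonflow_vectors X Es p" for p e
  proof -
    obtain t where "\<sigma> p e = \<sigma>0 (\<phi> t p) (dflow t p e)"
      unfolding \<sigma>_def by (rule flow_average_eq_value_on_orbit[OF \<sigma>0(1)])
    then show ?thesis
      using \<sigma>0_s e by (simp add: dflow_nonflow_vectors[OF line_s invariant_s])
  qed
  have "\<sigma> p (X p) = 0" for p by (rule \<sigma>_u[OF generator_in_plane[OF line_u]])
  then obtain \<tau> where \<tau>: "continuous_1form \<tau>"
      "\<And>p e v. e \<in> nonflow_vectors X Es p \<Longrightarrow> \<tau> p v = \<Omega> p (X p) e v / \<sigma> p e"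
    using exists_continuous_contraction[OF \<Omega> continuous_generator line_s \<sigma> _ \<sigma>_s] by blast
  show ?thesis
  proof (rule that[of \<alpha> \<sigma> \<tau>])
    show "continuous_1form \<alpha>" "(\<lambda>t. \<alpha> (\<phi> t p) (dflow t p v)) differentiable (at 0)" for p v
      unfolding \<alpha>_def using \<alpha>0(1)
      by (auto intro: continuous_1form_flow_average flow_average_differentiable)
    show "(\<lambda>t. \<tau> (\<phi> t p) (dflow t p v)) differentiable (at 0)" for p v
    proof -
      obtain e where e: "e \<in> nonflow_vectors X Es p"
        using nonflow_vectors_nonempty[OF line_s] by blast
      have "\<tau> (\<phi> t p) (dflow t p v)
          = pullback_form A (\<phi> t) \<Omega> p (X p) e v / \<sigma> (\<phi> t p) (dflow t p e)" for t
        using e by (subst \<tau>(2)[of "dflow t p e"])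
          (simp_all add: pullback_form_def dflow_generator dflow_nonflow_vectors[OF line_s invariant_s])
      moreover have "(\<lambda>t. pullback_form A (\<phi> t) \<Omega> p (X p) e v / \<sigma> (\<phi> t p) (dflow t p e))
          differentiable (at 0)"
        using \<Omega>_diff \<sigma>_diff[of p e] \<sigma>_s[OF e]
        by (intro differentiable_divide) (simp_all add: X_differentiable_form_def)
      ultimately show ?thesis by presburger
    qed
    show "\<tau> p v = 0" if v: "v \<in> plane Es p" for p v
    proof -
      obtain e where e: "e \<in> nonflow_vectors X Es p"
        using nonflow_vectors_nonempty[OF line_s] by blast
      obtain a b where "v = a *\<^sub>R e + b *\<^sub>R X p" using plane_span[OF line_s e v] by blast
      then show ?thesis
        by (simp add: \<tau>(2)[OF e] alternating_3form_add[OF \<Omega>p] alternating_3form_scale[OF \<Omega>p]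
            alternating_3form_zero[OF \<Omega>p])
    qed
    show "\<sigma> p e * \<tau> p f = \<Omega> p (X p) e f \<and> \<Omega> p (X p) e f \<noteq> 0"
      if "e \<in> nonflow_vectors X Es p" "f \<in> nonflow_vectors X Eu p" for p e f
      using \<tau>(2)[OF that(1), of f] \<sigma>_s[OF that(1)] \<Omega>_frame[OF that] by simp
  qed (use \<sigma> \<tau>(1) \<sigma>_diff \<sigma>_u \<alpha>_X in auto)
qed

text \<open>
  Declaring the coframe orthonormal makes \<open>ker \<alpha>\<close> the orthogonal complement of \<open>X\<close>, so the
  induced norm is \<open>\<bar>\<sigma>\<bar>\<close> on the stable line and \<open>\<bar>\<tau>\<bar>\<close> on the unstable line. The
  identity \<open>\<sigma>(e) \<tau>(f) = \<Omega>(X, e, f)\<close> holds at every time along the orbits of \<open>e\<close> and \<open>f\<close>; taking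
  logarithmic derivatives turns the product into the asserted sum.
\<close>

lemma exists_metric_with_divergence_splitting:
  assumes M: "compact (UNIV :: 'a set)" and n: "transversely_orientable A Eu"
    and \<Omega>: "volume_form A \<Omega>" and \<Omega>_diff: "X_differentiable_form A \<phi> \<Omega>"
  shows "\<exists>g. continuous_metric A g \<and> X_differentiable_metric A \<phi> g \<and>
           (\<forall>p. divergence A \<phi> \<Omega> p
                = expansion_rate A X \<phi> g Es p + expansion_rate A X \<phi> g Eu p)"
proof -
  obtain \<alpha> \<sigma> \<tau> where form: "continuous_1form \<alpha>" "continuous_1form \<sigma>" "continuous_1form \<tau>"
    and diff: "\<And>p v. (\<lambda>t. \<alpha> (\<phi> t p) (dflow t p v)) differentiable (at 0)"
      "\<And>p v. (\<lambda>t. \<sigma> (\<phi> t p) (dflow t p v)) differentiable (at 0)"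
      "\<And>p v. (\<lambda>t. \<tau> (\<phi> t p) (dflow t p v)) differentiable (at 0)"
    and \<alpha>_X: "\<And>p. \<alpha> p (X p) = 1"
    and \<sigma>_u: "\<And>p v. v \<in> plane Eu p \<Longrightarrow> \<sigma> p v = 0" and \<tau>_s: "\<And>p v. v \<in> plane Es p \<Longrightarrow> \<tau> p v = 0"
    and \<sigma>\<tau>: "\<And>p e f. e \<in> nonflow_vectors X Es p \<Longrightarrow> f \<in> nonflow_vectors X Eu p \<Longrightarrow>
        \<sigma> p e * \<tau> p f = \<Omega> p (X p) e f \<and> \<Omega> p (X p) e f \<noteq> 0"
    by (rule exists_adapted_coframe[OF assms]) blast
  have \<sigma>_X: "\<sigma> p (X p) = 0" and \<tau>_X: "\<tau> p (X p) = 0" for p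
    using \<sigma>_u \<tau>_s generator_in_plane line_s line_u by blast+
  note linear = form[THEN linear_1form]
  note add = linear[THEN linear_add] and scale = linear[THEN linear_cmul]
  define g where "g p v w = \<alpha> p v * \<alpha> p w + \<sigma> p v * \<sigma> p w + \<tau> p v * \<tau> p w" for p v w
  have g_pos: "g p v v > 0" if "v \<noteq> 0" for p v
  proof (rule ccontr)
    assume "\<not> g p v v > 0"
    then have "(\<alpha> p v)\<^sup>2 + (\<sigma> p v)\<^sup>2 + (\<tau> p v)\<^sup>2 \<le> 0"
      by (simp add: g_def power2_eq_square)
    then have zero: "\<alpha> p v = 0" "\<sigma> p v = 0" "\<tau> p v = 0"
      by (smt (verit) zero_le_power2 zero_eq_power2)+
    obtain e f where e: "e \<in> nonflow_vectors X Es p" and f: "f \<in> nonflow_vectors X Eu p"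
      using nonflow_vectors_nonempty line_s line_u by (metis ex_in_conv)
    then have nz: "\<sigma> p e \<noteq> 0" "\<tau> p f \<noteq> 0" and "\<sigma> p f = 0" "\<tau> p e = 0"
      using \<sigma>\<tau>[OF e f] \<sigma>_u[of f p] \<tau>_s[of e p] by (auto simp: nonflow_vectors_def)
    obtain x y z where v: "v = x *\<^sub>R X p + y *\<^sub>R e + z *\<^sub>R f"
      using frame_adapted[OF e f] unfolding frame_def by blast
    have "y = 0" "z = 0"
      using zero(2,3) nz \<open>\<sigma> p f = 0\<close> \<open>\<tau> p e = 0\<close> by (simp_all add: v add scale \<sigma>_X \<tau>_X)
    with zero(1) have "x = 0" by (simp add: v add scale \<alpha>_X)
    with \<open>y = 0\<close> \<open>z = 0\<close> \<open>v \<noteq> 0\<close> v show False by simp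
  qed
  have "continuous_metric A g"
    unfolding continuous_metric_def
  proof (intro conjI allI ballI impI)
    show "linear (g p v)" for p v
      by (intro linearI) (simp_all add: g_def add scale algebra_simps)
    show "g p v w = g p w v" for p v w by (simp add: g_def mult.commute)
    show "g p v v > 0" if "v \<noteq> 0" for p v by (rule g_pos[OF that])
    show "continuous_on (fst c) (\<lambda>p. g p (uncoord A c p v) (uncoord A c p w))" if "c \<in> A" for c v w
      unfolding g_def using form that by (intro continuous_intros) (simp_all add: continuous_1form_def)
  qed
  moreover have "X_differentiable_metric A \<phi> g"
    unfolding X_differentiable_metric_def
  proof (intro allI impI)
    fix p and v :: vec3 assume "v \<noteq> 0"
    have "(\<lambda>t. g (\<phi> t p) (dflow t p v) (dflow t p v)) differentiable (at 0)"
      unfolding g_def by (intro differentiable_add differentiable_mult diff)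
    then obtain D where "((\<lambda>t. g (\<phi> t p) (dflow t p v) (dflow t p v)) has_real_derivative D) (at 0)"
      by (auto simp: real_differentiable_def)
    from DERIV_chain2[OF DERIV_real_sqrt this] g_pos[OF \<open>v \<noteq> 0\<close>, of p]
    show "(\<lambda>t. sqrt (g (\<phi> t p) (dflow t p v) (dflow t p v))) differentiable (at 0)"
      by (auto simp: real_differentiable_def)
  qed
  moreover have "divergence A \<phi> \<Omega> p = expansion_rate A X \<phi> g Es p + expansion_rate A X \<phi> g Eu p" for p
  proof -
    have norm: "induced_norm X g p (qproj X p v) = sqrt ((\<sigma> p v)\<^sup>2 + (\<tau> p v)\<^sup>2)" for p v
    proof -
      have "orth_rep X g p (qproj X p v) = v - \<alpha> p v *\<^sub>R X p"
        unfolding orth_rep_def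
      proof (rule the_equality)
        show "v - \<alpha> p v *\<^sub>R X p \<in> qproj X p v \<and> g p (v - \<alpha> p v *\<^sub>R X p) (X p) = 0"
          by (auto simp: mem_qproj_iff g_def \<alpha>_X \<sigma>_X \<tau>_X linear[THEN linear_diff] scale
              intro: exI[of _ "- \<alpha> p v"])
        show "w = v - \<alpha> p v *\<^sub>R X p" if w: "w \<in> qproj X p v \<and> g p w (X p) = 0" for w
        proof -
          obtain a where a: "w = v + a *\<^sub>R X p" using w by (auto simp: mem_qproj_iff)
          have "\<alpha> p w = 0" using w by (simp add: g_def \<alpha>_X \<sigma>_X \<tau>_X)
          then have "a = - \<alpha> p v" by (simp add: a add scale \<alpha>_X)
          then show ?thesis by (simp add: a)
        qed
      qed
      then show ?thesis
        by (simp add: induced_norm_def g_def linear[THEN linear_diff] scale \<alpha>_X \<sigma>_X \<tau>_X power2_eq_square)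
    qed
    obtain e f where e: "e \<in> nonflow_vectors X Es p" and f: "f \<in> nonflow_vectors X Eu p"
      using nonflow_vectors_nonempty line_s line_u by (metis ex_in_conv)
    have nz: "\<sigma> p e \<noteq> 0" "\<tau> p f \<noteq> 0" using \<sigma>\<tau>[OF e f] by auto
    obtain D D' where D: "((\<lambda>t. \<sigma> (\<phi> t p) (dflow t p e)) has_real_derivative D) (at 0)"
        and D': "((\<lambda>t. \<tau> (\<phi> t p) (dflow t p f)) has_real_derivative D') (at 0)"
      using diff(2)[of p e] diff(3)[of p f] by (auto simp: real_differentiable_def)
    have "expansion_rate A X \<phi> g Es p = D / \<sigma> p e"
      using linear(2) \<sigma>_X norm \<tau>_s e nz(1) D
      by (intro expansion_rate_eq[OF line_s invariant_s]) simp_all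
    moreover have "expansion_rate A X \<phi> g Eu p = D' / \<tau> p f"
      using linear(3) \<tau>_X norm \<sigma>_u f nz(2) D'
      by (intro expansion_rate_eq[OF line_u invariant_u]) simp_all
    moreover have "divergence A \<phi> \<Omega> p = (D * \<tau> p f + D' * \<sigma> p e) / \<Omega> p (X p) e f"
    proof (rule divergence_eq[OF \<Omega> frame_adapted[OF e f]])
      have "pullback_form A (\<phi> t) \<Omega> p (X p) e f
          = \<sigma> (\<phi> t p) (dflow t p e) * \<tau> (\<phi> t p) (dflow t p f)" for t
        using \<sigma>\<tau>[of "dflow t p e" "\<phi> t p" "dflow t p f"] e f
        by (simp add: pullback_form_def dflow_generator dflow_nonflow_vectors[OF line_s invariant_s]
            dflow_nonflow_vectors[OF line_u invariant_u])
      moreover have "((\<lambda>t. \<sigma> (\<phi> t p) (dflow t p e) * \<tau> (\<phi> t p) (dflow t p f))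
          has_real_derivative D * \<tau> p f + D' * \<sigma> p e) (at 0)"
        using DERIV_mult[OF D D'] by simp
      ultimately show "((\<lambda>t. pullback_form A (\<phi> t) \<Omega> p (X p) e f)
          has_real_derivative D * \<tau> p f + D' * \<sigma> p e) (at 0)"
        by presburger
    qed
    moreover have "(D * \<tau> p f + D' * \<sigma> p e) / (\<sigma> p e * \<tau> p f) = D / \<sigma> p e + D' / \<tau> p f"
      using nz by (simp add: field_simps)
    ultimately show ?thesis using \<sigma>\<tau>[OF e f] by simp
  qed
  ultimately show ?thesis by blast
qed

end

section \<open>The divergence as sum of the expansion rates\<close>

lemma C1_Holder_field_continuous:
  assumes atlas: "smooth_atlas A" and X: "C1_Holder_field A X"
  shows "continuous_field_on A UNIV X"
proof -
  interpret smooth_manifold A by unfold_locales (rule atlas)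
  show ?thesis
    unfolding continuous_field_on_def
  proof
    fix c assume c: "c \<in> A"
    have "C_k_on 1 (local_field A X c) (snd c ` fst c)"
      using X c unfolding C1_Holder_field_def by blast
    then have "continuous_on (snd c ` fst c) (local_field A X c)"
      unfolding One_nat_def C_k_on.simps by (blast intro: differentiable_imp_continuous_on)
    then have "continuous_on (fst c) (\<lambda>p. local_field A X c (snd c p))"
      by (rule continuous_on_compose2[OF _ continuous_on_chart[OF c]]) simp
    then show "continuous_on (UNIV \<inter> fst c) (\<lambda>p. coord A c p (X p))"
      by (rule continuous_on_eq[THEN continuous_on_subset]) (simp_all add: local_field_def chart_inv_chart[OF c])
  qed
qed

theorem theorem1p1:
  fixes A :: "'a::t2_space chart set"
    and X :: "'a \<Rightarrow> vec3"
    and \<phi> :: "real \<Rightarrow> 'a \<Rightarrow> 'a"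
    and Es Eu :: "'a \<Rightarrow> vec3 set set"
    and \<Omega> :: "'a \<Rightarrow> vec3 \<Rightarrow> vec3 \<Rightarrow> vec3 \<Rightarrow> real"
  assumes "closed_connected_oriented_3manifold A"
    and "C1_Holder_field A X"
    and "\<forall>p. X p \<noteq> 0"
    and "C1_flow A \<phi>"
    and "generates A X \<phi>"
    and "projectively_Anosov_splitting A X \<phi> Es Eu"
    and "transversely_orientable A Es"
    and "transversely_orientable A Eu"
    and "volume_form A \<Omega>"
    and "X_differentiable_form A \<phi> \<Omega>"
  shows "\<exists>g. continuous_metric A g \<and> X_differentiable_metric A \<phi> g \<and>
           (\<forall>p. divergence A \<phi> \<Omega> p
                = expansion_rate A X \<phi> g Es p + expansion_rate A X \<phi> g Eu p)"
proof -
  have atlas: "smooth_atlas A" and M: "compact (UNIV :: 'a set)"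
    using assms(1) by (simp_all add: closed_connected_oriented_3manifold_def oriented_atlas_def)
  interpret invariant_splitting A X \<phi> Es Eu
    using assms C1_Holder_field_continuous[OF atlas] by unfold_locales (auto simp: atlas)
  show ?thesis
    using M assms by (intro exists_metric_with_divergence_splitting)
qed

end
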